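(* Consider problem (P) under the standing assumptions of the context, and let $\{\gamma_k\}$ and $\{t_k\}$ be generated by the algorithm sESQM described in the context. Suppose that: (CQ) $0\notin \partial g(x)+\mathcal{N}_{\mathcal{C}}(x)$ for every $x\in\mathcal{C}$ with $g(x)\ge 0$; (Parameters) $\{\mu_k\}$ is positive and nonincreasing, $\lim_{k\to\infty}\mu_k=0$, and $S_K:=\sum_{k=\lceil K/2\rceil}^{K}\mu_k\to\infty$ as $K\to\infty$; moreover $\lim_{k\to\infty}\widehat\gamma_k=0$ and there is $M_{\widehat\gamma}>1$ with $0<\widehat\gamma_{k+1}<\widehat\gamma_k\le M_{\widehat\gamma}\widehat\gamma_{k+1}$ for all $k\in\mathbb{N}_0$. Let $\eta_1>0$ be a constant such that $\mathrm{dist}(0,Dc(x)^*u+\mathcal{N}_{\mathcal{C}}(x))\ge\eta_1$ for every $x\in\mathcal{C}$ with $g(x)\ge-\eta_1$ and every $u\in\partial_{\eta_1}h(c(x))$. Then for all $k\in\mathbb{N}_0$, $$\gamma_k\ge\eta_\gamma:=\min\left\{\frac{\eta_1}{2M_{\widehat\gamma}\left(M_f+M_{P_1}+M_{P_2}+c_2(M_L+\mu_0L_{\mu_0})\right)},\ \widehat\gamma_{k_0+1}\right\}>0,$$ where $$k_0:=\min\left\{k\in\mathbb{N}_0:\ \mu_k\le \eta_1/\max\{\alpha_3^h,[\alpha_{3,2}^h]_+\}\right\}\in[0,\infty).$$ Moreover, the index set $\mathfrak{I}:=\{k\in\mathbb{N}_0: t_{k+1}\ne t_k\}$ is finite and satisfies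 $$|\mathfrak{I}|\le M_{\bar t}:=\max\{t\in\mathbb{N}_0:\widehat\gamma_t\ge\eta_\gamma\}\in[k_0+1,\infty).$$
   Context: **Notation.** $\mathbb{N}_0=\{0,1,2,\dots\}$; $[s]_+=\max\{s,0\}$; $\phi^+=\max\{\phi,0\}$; $\delta_{\mathcal{C}}$ is the indicator function (0 on $\mathcal{C}$, $+\infty$ off it); $\mathcal{N}_{\mathcal{C}}=\partial\delta_{\mathcal{C}}$ is the normal cone; $\partial_\epsilon\phi(x)=\{\xi:\phi(z)\ge\phi(x)+\langle\xi,z-x\rangle-\epsilon\ \forall z\}$ for convex $\phi$; $\partial$ is the limiting subdifferential (the usual one for convex functions); in the present setting $\partial g(x)=Dc(x)^*\partial h(c(x))$. "$L$-smooth on $\mathcal{C}$" means the derivative is $L$-Lipschitz on $\mathcal{C}$. $Dc(x)^*$ is the adjoint of the derivative. **Problem (P).** $\mathbb{X},\mathbb{Y}$ are finite-dimensional real Hilbert spaces: $$\min_{x\in\mathbb{X}}\ \psi(x):=f(x)+P_1(x)-P_2(x)+\delta_{\mathcal{C}}(x)\quad\text{s.t.}\quad g(x):=h(c(x))\le 0.$$ Standing assumptions: (i) $\mathcal{C}\subseteq\mathbb{X}$ is compact and convex and $\mathcal{F}:=\{x\in\mathcal{C}:g(x)\le0\}\ne\emptyset$; (ii) $f:\mathbb{X}\to\mathbb{R}$ and $c:\mathbb{X}\to\mathbb{Y}$ are continuously differentiable, $L_f$-smooth and $L_c$-smooth on $\mathcal{C}$ respectively ($L_f>0$, $L_c\ge0$),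 and $c$ is $M_c$-Lipschitz on $\mathcal{C}$ with $M_c>0$; (iii) $P_1,P_2:\mathbb{X}\to\mathbb{R}$ are convex; (iv) $h:\mathbb{Y}\to\mathbb{R}$ is convex and $M_h$-Lipschitz with $M_h>0$. **Smoothing.** A family of convex $C^1$ functions $\{\phi_\mu\}_{\mu>0}$ is a smoothing approximation (SA) of a convex $\phi:\mathbb{Y}\to\mathbb{R}$ with parameters $(\alpha_1^\phi,\alpha_2^\phi,\alpha_{3,1}^\phi,\alpha_{3,2}^\phi)$, where $\alpha_1^\phi\ge0$, $\alpha_2^\phi>0$, $\alpha_{3,1}^\phi,\alpha_{3,2}^\phi\in\mathbb{R}$ and $\alpha_3^\phi:=\alpha_{3,1}^\phi+\alpha_{3,2}^\phi>0$, if for all $\mu>0$: $\nabla\phi_\mu$ is $(\alpha_1^\phi+\alpha_2^\phi/\mu)$-Lipschitz and $\phi-\alpha_{3,1}^\phi\mu\le\phi_\mu\le\phi+\alpha_{3,2}^\phi\mu$ pointwise. Fixed throughout: an SA $\{h_\mu\}$ of $h$ with parameters $(\alpha_1^h,\alpha_2^h,\alpha_{3,1}^h,\alpha_{3,2}^h)$ and a constant $\alpha_4^h\ge0$ with $h_{\mu_1}(y)\le h_{\mu_0}(y)+\alpha_4^h(\mu_0-\mu_1)$ for all $\mu_0\ge\mu_1>0$, $y\in\mathbb{Y}$; and an SA $\{\varphi_\mu\}$ of $[\cdot]_+:\mathbb{R}\to\mathbb{R}$ with parameters $(\alpha_1^\varphi,\alpha_2^\varphi,\alpha_{3,1}^\varphi,\alpha_{3,2}^\varphi)$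 and a constant $\alpha_4^\varphi\ge0$ with $\varphi_{\mu_1}(s)\le\varphi_{\mu_0}(s)+\alpha_4^\varphi(\mu_0-\mu_1)$ for all $\mu_0\ge\mu_1>0$, $s\in\mathbb{R}$. Set $H_\mu:=\varphi_\mu\circ h_\mu$, $g_\mu:=H_\mu\circ c$, $\alpha_1=\alpha_1^h+M_h^2\alpha_1^\varphi$, $\alpha_2=\alpha_2^h+M_h^2\alpha_2^\varphi$, and $L_\mu:=M_hL_c+\alpha_1M_c^2+\alpha_2M_c^2/\mu$. **Algorithm sESQM.** Inputs: $x^0\in\mathcal{C}$, $\mu_0>0$, $\overline L\ge\underline L>0$, $c_1>0$, $c_2>0$, a strictly decreasing positive sequence $\{\widehat\gamma_k\}$, and the SAs above. Set $t_0=0$. For $k=0,1,2,\dots$: Step 1: take $\xi^k\in\partial P_2(x^k)$, $L_{k,0}\in[\underline L,\overline L]$; set $\gamma_k=\widehat\gamma_{t_k}$, $\widetilde L=L_{k,0}$. Step 2: compute $\widetilde x=\arg\min_{x\in\mathbb{X}}\{\gamma_k(\langle\nabla f(x^k)-\xi^k,x\rangle+P_1(x))+\ell_k(x)+\frac{\widetilde L}{2\mu_k}\|x-x^k\|^2+\delta_{\mathcal{C}}(x)\}$ with $\ell_k(x):=g_{\mu_k}(x^k)+\langle\nabla g_{\mu_k}(x^k),x-x^k\rangle$. Step 3: if $\gamma_k\psi(\widetilde x)+g_{\mu_k}(\widetilde x)\le\gamma_k\psi(x^k)+g_{\mu_k}(x^k)-\frac{c_1}{2\mu_k}\|\widetilde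 x-x^k\|^2$ go to Step 4; otherwise replace $\widetilde L$ by $2\widetilde L$ and go to Step 2. Step 4: set $x^{k+1}=\widetilde x$, $L_k=\widetilde L$. If $h_{\mu_k}(c(x^{k+1}))>2\alpha_3^\varphi\mu_k$ and $\|x^{k+1}-x^k\|\le c_2\mu_k\gamma_k$, set $t_{k+1}=t_k+1$; otherwise $t_{k+1}=t_k$. Step 5: choose $\mu_{k+1}\in(0,\mu_k]$. **Constants.** $M_L:=\max\{\overline L,\ c_1+\gamma_0\mu_0L_f+\mu_0L_{\mu_0}\}$; $M_f:=\sup_{x\in\mathcal{C}}\|\nabla f(x)\|$; $M_{P_i}:=\sup\{\|\xi\|:\xi\in\partial P_i(x),x\in\mathcal{C}\}$, $i=1,2$. *)

theory Defs
  imports "HOL-Analysis.Analysis" "HOL-Library.Set_Algebras"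
begin

definition fderiv :: "('a::real_normed_vector \<Rightarrow> 'b::real_normed_vector) \<Rightarrow> 'a \<Rightarrow> 'a \<Rightarrow>\<^sub>L 'b" where
  "fderiv F x = Blinfun (frechet_derivative F (at x))"

definition gradient :: "('a::real_inner \<Rightarrow> real) \<Rightarrow> 'a \<Rightarrow> 'a" where
  "gradient F x = (THE d. GDERIV F x :> d)"

definition continuously_differentiable ::
  "('a::real_normed_vector \<Rightarrow> 'b::real_normed_vector) \<Rightarrow> bool" where
  "continuously_differentiable F \<longleftrightarrow>
     (\<forall>x. F differentiable (at x)) \<and> continuous_on UNIV (fderiv F)"

definition smooth_on ::
  "real \<Rightarrow> 'a set \<Rightarrow> ('a::real_normed_vector \<Rightarrow> 'b::real_normed_vector) \<Rightarrow> bool" where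
  "smooth_on L S F \<longleftrightarrow> L-lipschitz_on S (fderiv F)"

definition ind_fun :: "'a set \<Rightarrow> 'a \<Rightarrow> ereal" where
  "ind_fun C x = (if x \<in> C then 0 else \<infinity>)"

(* Only applied to convex functions, at points where they are finite. *)
definition eps_subdifferential :: "real \<Rightarrow> ('a::real_inner \<Rightarrow> ereal) \<Rightarrow> 'a \<Rightarrow> 'a set" where
  "eps_subdifferential \<epsilon> \<phi> x = {\<xi>. \<forall>z. \<phi> z \<ge> \<phi> x + ereal (\<xi> \<bullet> (z - x)) - ereal \<epsilon>}"

definition subdifferential :: "('a::real_inner \<Rightarrow> ereal) \<Rightarrow> 'a \<Rightarrow> 'a set" where
  "subdifferential \<phi> = eps_subdifferential 0 \<phi>"

definition normal_cone :: "'a::real_inner set \<Rightarrow> 'a \<Rightarrow> 'a set" where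
  "normal_cone C = subdifferential (ind_fun C)"

(* Frechet (regular) and limiting (Mordukhovich) subdifferentials of real-valued functions,
   which need not be convex. *)
definition regular_subdifferential :: "('a::real_inner \<Rightarrow> real) \<Rightarrow> 'a \<Rightarrow> 'a set" where
  "regular_subdifferential \<phi> x =
     {\<xi>. 0 \<le> Liminf (at x) (\<lambda>z. ereal ((\<phi> z - \<phi> x - \<xi> \<bullet> (z - x)) / norm (z - x)))}"

definition limiting_subdifferential :: "('a::real_inner \<Rightarrow> real) \<Rightarrow> 'a \<Rightarrow> 'a set" where
  "limiting_subdifferential \<phi> x =
     {\<xi>. \<exists>X \<Xi>. X \<longlonglongrightarrow> x \<and> (\<lambda>n. \<phi> (X n)) \<longlonglongrightarrow> \<phi> x \<and>
          (\<forall>n. \<Xi> n \<in> regular_subdifferential \<phi> (X n)) \<and> \<Xi> \<longlonglongrightarrow> \<xi>}"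

definition smoothing_approximation ::
  "('a::real_inner \<Rightarrow> real) \<Rightarrow> (real \<Rightarrow> 'a \<Rightarrow> real) \<Rightarrow> real \<Rightarrow> real \<Rightarrow> real \<Rightarrow> real \<Rightarrow> bool" where
  "smoothing_approximation \<phi> \<phi>s a1 a2 a31 a32 \<longleftrightarrow>
     a1 \<ge> 0 \<and> a2 > 0 \<and> a31 + a32 > 0 \<and>
     (\<forall>\<mu>>0. convex_on UNIV (\<phi>s \<mu>) \<and> continuously_differentiable (\<phi>s \<mu>) \<and>
        (a1 + a2 / \<mu>)-lipschitz_on UNIV (gradient (\<phi>s \<mu>)) \<and>
        (\<forall>y. \<phi> y - a31 * \<mu> \<le> \<phi>s \<mu> y \<and> \<phi>s \<mu> y \<le> \<phi> y + a32 * \<mu>))"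

definition smooth_constraint ::
  "(real \<Rightarrow> real \<Rightarrow> real) \<Rightarrow> (real \<Rightarrow> 'b \<Rightarrow> real) \<Rightarrow> ('a \<Rightarrow> 'b) \<Rightarrow> real \<Rightarrow> 'a \<Rightarrow> real" where
  "smooth_constraint \<phi>s hs c \<mu> = \<phi>s \<mu> \<circ> hs \<mu> \<circ> c"

definition objective ::
  "('a \<Rightarrow> real) \<Rightarrow> ('a \<Rightarrow> real) \<Rightarrow> ('a \<Rightarrow> real) \<Rightarrow> 'a set \<Rightarrow> 'a \<Rightarrow> ereal" where
  "objective f P1 P2 C x = ereal (f x + P1 x - P2 x) + ind_fun C x"

(* Objective of the subproblem at the iterate xk, where G is the smoothed constraint function
   and Lt the current trial constant. *)
definition subproblem_objective ::
  "('a::real_inner \<Rightarrow> real) \<Rightarrow> ('a \<Rightarrow> real) \<Rightarrow> 'a set \<Rightarrow> ('a \<Rightarrow> real) \<Rightarrow> 'a \<Rightarrow> 'a \<Rightarrow> real \<Rightarrow> real \<Rightarrow> real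
     \<Rightarrow> 'a \<Rightarrow> ereal" where
  "subproblem_objective f P1 C G xk \<xi> \<gamma> \<mu> Lt x =
     ereal (\<gamma> * ((gradient f xk - \<xi>) \<bullet> x + P1 x)
            + (G xk + gradient G xk \<bullet> (x - xk))
            + Lt / (2 * \<mu>) * (norm (x - xk))\<^sup>2)
     + ind_fun C x"

definition sufficient_descent ::
  "('a::real_normed_vector \<Rightarrow> ereal) \<Rightarrow> ('a \<Rightarrow> real) \<Rightarrow> real \<Rightarrow> real \<Rightarrow> real \<Rightarrow> 'a \<Rightarrow> 'a \<Rightarrow> bool" where
  "sufficient_descent \<psi> G c1 \<gamma> \<mu> xk y \<longleftrightarrow>
     ereal \<gamma> * \<psi> y + ereal (G y)
       \<le> ereal \<gamma> * \<psi> xk + ereal (G xk) - ereal (c1 / (2 * \<mu>) * (norm (y - xk))\<^sup>2)"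

(* Sequences x, mu, t, gamma generated by sESQM. For each k, the backtracking loop tries the
   constants 2^i * L0 k with subproblem solutions y k i, and stops at the first index i = j k
   that passes the descent test. a3 is the constant alpha_3 of the smoothing of the positive part. *)
definition sESQM ::
  "('a::euclidean_space \<Rightarrow> real) \<Rightarrow> ('a \<Rightarrow> real) \<Rightarrow> ('a \<Rightarrow> real) \<Rightarrow> 'a set \<Rightarrow> ('a \<Rightarrow> 'b) \<Rightarrow>
   (real \<Rightarrow> 'b \<Rightarrow> real) \<Rightarrow> (real \<Rightarrow> real \<Rightarrow> real) \<Rightarrow> real \<Rightarrow>
   real \<Rightarrow> real \<Rightarrow> real \<Rightarrow> real \<Rightarrow> (nat \<Rightarrow> real) \<Rightarrow>
   (nat \<Rightarrow> 'a) \<Rightarrow> (nat \<Rightarrow> real) \<Rightarrow> (nat \<Rightarrow> nat) \<Rightarrow> (nat \<Rightarrow> real) \<Rightarrow> bool" where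
  "sESQM f P1 P2 C c hs \<phi>s a3 Lmin Lmax c1 c2 \<gamma>hat x \<mu> t \<gamma> \<longleftrightarrow>
     x 0 \<in> C \<and> \<mu> 0 > 0 \<and> 0 < Lmin \<and> Lmin \<le> Lmax \<and> c1 > 0 \<and> c2 > 0 \<and>
     (\<forall>k. \<gamma>hat k > 0) \<and> (\<forall>k. \<gamma>hat (Suc k) < \<gamma>hat k) \<and> t 0 = 0 \<and>
     (\<exists>\<xi> L0 y j. \<forall>k.
        let G = smooth_constraint \<phi>s hs c (\<mu> k) in
        \<xi> k \<in> subdifferential (ereal \<circ> P2) (x k) \<and> L0 k \<in> {Lmin..Lmax} \<and> \<gamma> k = \<gamma>hat (t k) \<and>
        (\<forall>i\<le>j k. is_arg_min
           (subproblem_objective f P1 C G (x k) (\<xi> k) (\<gamma> k) (\<mu> k) (2 ^ i * L0 k)) (\<lambda>_. True) (y k i)) \<and>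
        (\<forall>i<j k. \<not> sufficient_descent (objective f P1 P2 C) G c1 (\<gamma> k) (\<mu> k) (x k) (y k i)) \<and>
        sufficient_descent (objective f P1 P2 C) G c1 (\<gamma> k) (\<mu> k) (x k) (y k (j k)) \<and>
        x (Suc k) = y k (j k) \<and>
        t (Suc k) =
          (if hs (\<mu> k) (c (x (Suc k))) > 2 * a3 * \<mu> k \<and>
              norm (x (Suc k) - x k) \<le> c2 * \<mu> k * \<gamma> k
           then t k + 1 else t k) \<and>
        0 < \<mu> (Suc k) \<and> \<mu> (Suc k) \<le> \<mu> k)"

definition sup_subgradient_norm :: "('a::real_inner \<Rightarrow> real) \<Rightarrow> 'a set \<Rightarrow> real" where
  "sup_subgradient_norm P C = Sup {norm \<xi> |\<xi> x. x \<in> C \<and> \<xi> \<in> subdifferential (ereal \<circ> P) x}"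

end

theory Submission
  imports Defs
begin

text \<open>
  The threshold for the penalty parameter comes from a conflict between stationarity and regularity.
  Suppose that the parameter is reduced in iteration k, and let y be the new iterate. The optimality
  condition of the subproblem says that the gradient of the smoothed constraint at the old iterate
  lies, up to the penalty times bounded data and the proximal term, in the negative normal cone
  at y. A reduction happens only if the step is at most c2 mu_k gamma_k, so passing to the
  gradient at y and dropping the proximal term both cost only a multiple of gamma_k: the gradient of
  the smoothed constraint at y is within gamma_k D of the negative normal cone, where D is the sum
  in the denominator of the claimed bound (lemma constraint_gradient_residual).

  On the other hand, this gradient is the product of the slope of the smoothed positive part and a
  vector Dc(y)*u, where u is the gradient of the smoothed h. The other condition for a reduction, that
  the smoothed value of h exceeds 2 alpha_3 mu_k with alpha_3 from the positive part, forces the slope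
  to be at least 1/2. As the smoothing errors are of order mu_k, the vector u is an
  eta_1-subgradient of h and y is infeasible up to eta_1 as soon as k is at least k_0. The
  quantitative constraint qualification then keeps Dc(y)*u at distance eta_1 from the negative
  normal cone. Comparing both gives eta_1 <= 2 gamma_k D (lemma regularity_bounds_residual). So
  reductions from k_0 on start from parameters that are not small, and one reduction loses at most
  the factor M_gammahat; before k_0 at most k_0 reductions are possible. This is the lower bound,
  and as the sequence of candidates tends to zero, it also bounds the number of reductions.

  Two facts make the constants explicit. Backtracking stops at a constant of at most M_L, because the
  optimality condition at the old iterate yields twice the proximal term as decrease (lemma
  sufficient_descent_of_large_constant). And mu L_mu is nondecreasing in mu, so it is bounded by its value
  at mu_0. Since c is Lipschitz only on C, which may have empty interior, gradients of the composite
  constraint are only ever tested against directions that point from a point of C into C; in these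
  directions the derivative of c is bounded by the Lipschitz constant.
\<close>

section \<open>Gradients and derivatives\<close>

lemma gradient_unique: "GDERIV F x :> d \<Longrightarrow> gradient F x = d"
proof -
  assume d: "GDERIV F x :> d"
  have "e = d" if "GDERIV F x :> e" for e
  proof -
    have "(\<lambda>v. v \<bullet> d) = (\<lambda>v. v \<bullet> e)"
      using d that unfolding gderiv_def by (rule has_derivative_unique)
    then have "v \<bullet> (e - d) = 0" for v
      by (metis inner_diff_right right_minus_eq)
    then show "e = d" by (metis inner_eq_zero_iff right_minus_eq)
  qed
  with d show ?thesis unfolding gradient_def by (intro the_equality)
qed

lemma gderiv_gradient:
  fixes F :: "'a::euclidean_space \<Rightarrow> real"
  assumes "F differentiable (at x)"
  shows "GDERIV F x :> gradient F x"
proof -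
  obtain F' where F': "(F has_derivative F') (at x)"
    using assms by (auto simp: differentiable_def)
  have lin: "linear F'"
    using F' has_derivative_linear by blast
  have "F' = (\<lambda>v. v \<bullet> adjoint F' 1)"
    using adjoint_works[OF lin, of _ 1] by auto
  then have "GDERIV F x :> adjoint F' 1"
    using F' by (simp add: gderiv_def)
  then show ?thesis using gradient_unique by metis
qed

lemma has_derivative_fderiv:
  assumes "continuously_differentiable F"
  shows "(F has_derivative blinfun_apply (fderiv F x)) (at x)"
proof -
  have "(F has_derivative frechet_derivative F (at x)) (at x)"
    using assms by (simp add: continuously_differentiable_def flip: frechet_derivative_works)
  then show ?thesis
    unfolding fderiv_def
    by (simp add: bounded_linear_Blinfun_apply has_derivative_bounded_linear)
qed

lemma gderiv_gradient_C1:
  fixes F :: "'a::euclidean_space \<Rightarrow> real"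
  assumes "continuously_differentiable F"
  shows "GDERIV F x :> gradient F x"
  using assms by (simp add: continuously_differentiable_def gderiv_gradient)

lemma fderiv_inner_gradient:
  fixes F :: "'a::euclidean_space \<Rightarrow> real"
  assumes "continuously_differentiable F"
  shows "fderiv F x v = gradient F x \<bullet> v"
  using has_derivative_unique[OF has_derivative_fderiv[OF assms, of x]
      gderiv_gradient_C1[OF assms, of x, unfolded gderiv_def]]
  by (simp add: inner_commute)

lemma norm_gradient_le:
  fixes F :: "'a::euclidean_space \<Rightarrow> real"
  assumes "continuously_differentiable F"
  shows "norm (gradient F x) \<le> norm (fderiv F x)"
proof -
  have "norm (gradient F x) * norm (gradient F x) = fderiv F x (gradient F x)"
    by (simp add: fderiv_inner_gradient[OF assms] flip: power2_norm_eq_inner power2_eq_square)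
  also have "\<dots> \<le> norm (fderiv F x) * norm (gradient F x)"
    using norm_blinfun[of "fderiv F x" "gradient F x"] by simp
  finally show ?thesis
    by (metis mult_right_le_imp_le norm_ge_zero order_le_less)
qed

lemma bdd_above_norm_gradient:
  fixes F :: "'a::euclidean_space \<Rightarrow> real"
  assumes "continuously_differentiable F" "compact C"
  shows "bdd_above ((\<lambda>z. norm (gradient F z)) ` C)"
proof -
  have "compact (fderiv F ` C)"
    using assms by (intro compact_continuous_image)
      (auto simp: continuously_differentiable_def intro: continuous_on_subset)
  then obtain B where "\<And>z. z \<in> C \<Longrightarrow> norm (fderiv F z) \<le> B"
    using compact_imp_bounded bounded_iff by (metis imageI)
  then show ?thesis
    using norm_gradient_le[OF assms(1)] by (meson bdd_aboveI2 order_trans)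
qed

lemma has_derivative_line:
  "((\<lambda>s. x + s *\<^sub>R v) has_derivative (\<lambda>h. h *\<^sub>R v)) (at s)"
  by (auto intro!: derivative_eq_intros)

lemma gderiv_along_line:
  assumes "GDERIV F (x + s *\<^sub>R v) :> d"
  shows "((\<lambda>s. F (x + s *\<^sub>R v)) has_real_derivative (d \<bullet> v)) (at s)"
proof -
  have "((\<lambda>s. F (x + s *\<^sub>R v)) has_derivative (\<lambda>h. (h *\<^sub>R v) \<bullet> d)) (at s)"
    using has_derivative_compose[OF has_derivative_line[of x v s] assms[unfolded gderiv_def]] .
  then show ?thesis
    unfolding has_field_derivative_def by (simp add: inner_commute mult_commute_abs)
qed

lemma convex_gradient_inequality:
  assumes "convex_on UNIV F" "GDERIV F x :> d"
  shows "F x + d \<bullet> (z - x) \<le> F z"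
proof -
  let ?q = "\<lambda>s. F (x + s *\<^sub>R (z - x))"
  have "convex_on UNIV ?q"
  proof (rule convex_onI)
    fix u a b :: real
    assume "0 < u" "u < 1"
    have "x + ((1 - u) *\<^sub>R a + u *\<^sub>R b) *\<^sub>R (z - x)
        = (1 - u) *\<^sub>R (x + a *\<^sub>R (z - x)) + u *\<^sub>R (x + b *\<^sub>R (z - x))"
      by (simp add: algebra_simps)
    then show "?q ((1 - u) *\<^sub>R a + u *\<^sub>R b) \<le> (1 - u) * ?q a + u * ?q b"
      using convex_onD[OF assms(1), of u "x + a *\<^sub>R (z - x)" "x + b *\<^sub>R (z - x)"]
        \<open>0 < u\<close> \<open>u < 1\<close> by simp
  qed simp
  moreover have "(?q has_real_derivative d \<bullet> (z - x)) (at 0)"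
    using gderiv_along_line[of F x 0 "z - x" d] assms(2) by simp
  ultimately have "?q 1 - ?q 0 \<ge> (d \<bullet> (z - x)) * (1 - 0)"
    by (intro convex_on_imp_above_tangent[where A = UNIV]) auto
  then show ?thesis by simp
qed

lemma convex_segment_mem:
  assumes "convex C" "x \<in> C" "z \<in> C" "0 \<le> s" "s \<le> (1::real)"
  shows "x + s *\<^sub>R (z - x) \<in> C"
  using convexD_alt[OF assms(1-3), of s] assms(4,5) by (simp add: algebra_simps)

text \<open>
  The increment of the gradient is tested only against the direction of the segment, which keeps the
  lemma applicable when the gradient is known to be Lipschitz only along directions inside C.
\<close>
lemma descent_lemma:
  assumes C: "convex C" "x \<in> C" "z \<in> C"
    and G: "\<And>y. GDERIV F y :> G y"
    and L: "\<And>y. y \<in> C \<Longrightarrow> (G y - G x) \<bullet> (z - x) \<le> L * norm (y - x) * norm (z - x)"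
  shows "F z \<le> F x + G x \<bullet> (z - x) + L / 2 * (norm (z - x))\<^sup>2"
proof -
  define v where "v = z - x"
  define q where "q = (\<lambda>s. F (x + s *\<^sub>R v) - s * (G x \<bullet> v) - L / 2 * s\<^sup>2 * (norm v)\<^sup>2)"
  have "q 1 \<le> q 0"
  proof (rule DERIV_nonpos_imp_nonincreasing[where f = q and a = 0 and b = 1])
    fix s :: real
    assume s: "0 \<le> s" "s \<le> 1"
    let ?y = "x + s *\<^sub>R v"
    have "(q has_real_derivative (G ?y \<bullet> v - G x \<bullet> v - L * s * (norm v)\<^sup>2)) (at s)"
      unfolding q_def
      by (rule derivative_eq_intros gderiv_along_line[OF G] refl | simp)+
    moreover have "G ?y \<bullet> v - G x \<bullet> v \<le> L * s * (norm v)\<^sup>2"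
      using L[of ?y] convex_segment_mem[OF C s] s
      by (simp add: v_def inner_diff_left power2_eq_square mult.assoc)
    ultimately show "\<exists>y. (q has_real_derivative y) (at s) \<and> y \<le> 0" by fastforce
  qed simp
  then show ?thesis by (simp add: q_def v_def)
qed

text \<open>
  Turns a bound along a segment into one for the directional derivative. It is one-sided because a
  segment inside a convex set may end at the base point.
\<close>
lemma derivative_le_of_right_bound:
  fixes q :: "real \<Rightarrow> real"
  assumes "(q has_real_derivative d) (at 0)"
    and bound: "\<And>s. 0 < s \<Longrightarrow> s \<le> 1 \<Longrightarrow> q s \<le> q 0 + K * s"
  shows "d \<le> K"
proof (rule ccontr)
  assume "\<not> d \<le> K"
  then have "0 < d - K" by simp
  moreover have "((\<lambda>s. q s - K * s) has_real_derivative (d - K)) (at 0)"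
    using assms(1) by (auto intro!: derivative_eq_intros)
  ultimately obtain e where e: "e > 0" "\<And>s. 0 < s \<Longrightarrow> s < e \<Longrightarrow> q 0 < q s - K * s"
    using DERIV_pos_inc_right[of "\<lambda>s. q s - K * s" "d - K" 0] by auto
  have "q 0 < q (min (e / 2) 1) - K * min (e / 2) 1"
    using e by (intro e(2)) auto
  then show False using bound[of "min (e / 2) 1"] e(1) by simp
qed

text \<open>
  A Lipschitz constant on C bounds difference quotients, hence the derivative, only along directions that
  stay in C; if C has empty interior, the operator norm of the derivative may be larger. Testing with
  the image D w itself reduces the claim to a scalar function.
\<close>
lemma norm_derivative_feasible_direction:
  fixes F :: "'a::real_normed_vector \<Rightarrow> 'b::real_inner"
  assumes C: "convex C" "y \<in> C" "z \<in> C"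
    and lip: "M-lipschitz_on C F"
    and D: "(F has_derivative D) (at y)"
  shows "norm (D (z - y)) \<le> M * norm (z - y)"
proof -
  define w where "w = z - y"
  define q where "q = (\<lambda>s. F (y + s *\<^sub>R w) \<bullet> D w)"
  have lin: "linear D" using D has_derivative_linear by blast
  have D': "(F has_derivative D) (at (y + 0 *\<^sub>R w))" using D by simp
  have "((\<lambda>s. F (y + s *\<^sub>R w)) has_derivative (\<lambda>s. D (s *\<^sub>R w))) (at 0)"
    using has_derivative_compose[OF has_derivative_line D'] .
  then have "(q has_derivative (\<lambda>s. D (s *\<^sub>R w) \<bullet> D w)) (at 0)"
    unfolding q_def by (rule has_derivative_inner_left)
  then have "(q has_real_derivative (D w \<bullet> D w)) (at 0)"
    by (simp add: has_field_derivative_def linear_cmul[OF lin] mult_commute_abs)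
  then have "D w \<bullet> D w \<le> M * norm w * norm (D w)"
  proof (rule derivative_le_of_right_bound)
    fix s :: real
    assume s: "0 < s" "s \<le> 1"
    have "q s - q 0 \<le> norm (F (y + s *\<^sub>R w) - F y) * norm (D w)"
      unfolding q_def by (simp add: norm_cauchy_schwarz flip: inner_diff_left)
    also have "\<dots> \<le> (M * norm (s *\<^sub>R w)) * norm (D w)"
      using lipschitz_on_normD[OF lip, of "y + s *\<^sub>R w" y] convex_segment_mem[OF C, of s] s C
      by (intro mult_right_mono) (auto simp: w_def)
    finally show "q s \<le> q 0 + M * norm w * norm (D w) * s"
      using s by (simp add: algebra_simps)
  qed
  then have "norm (D w) * norm (D w) \<le> M * norm w * norm (D w)"
    by (simp flip: power2_norm_eq_inner power2_eq_square)
  moreover have "0 \<le> M * norm w" using lipschitz_on_nonneg[OF lip] by simp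
  ultimately have "norm (D w) \<le> M * norm w"
    by (metis mult_right_le_imp_le norm_ge_zero order_le_less)
  then show ?thesis by (simp add: w_def)
qed

section \<open>Subgradients and normal cones\<close>

lemma eps_subdifferential_real_iff:
  "\<xi> \<in> eps_subdifferential e (ereal \<circ> F) x \<longleftrightarrow> (\<forall>z. F x + \<xi> \<bullet> (z - x) - e \<le> F z)"
  by (simp add: eps_subdifferential_def)

lemma subdifferential_real_iff:
  "\<xi> \<in> subdifferential (ereal \<circ> F) x \<longleftrightarrow> (\<forall>z. F x + \<xi> \<bullet> (z - x) \<le> F z)"
  by (simp add: subdifferential_def eps_subdifferential_real_iff)

lemma normal_cone_iff:
  "x \<in> C \<Longrightarrow> n \<in> normal_cone C x \<longleftrightarrow> (\<forall>z\<in>C. n \<bullet> (z - x) \<le> 0)"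
  by (auto simp: normal_cone_def subdifferential_def eps_subdifferential_def ind_fun_def
      zero_ereal_def split: if_splits)

text \<open>
  Moving far enough in the direction of the subgradient makes the error e negligible against the
  linear growth, so eps-subgradients obey the same bound as exact ones. Gradients of smoothings
  inherit the Lipschitz constant of the original function in this way.
\<close>
lemma norm_eps_subgradient_le:
  assumes lip: "M-lipschitz_on UNIV F"
    and \<xi>: "\<xi> \<in> eps_subdifferential e (ereal \<circ> F) y"
  shows "norm \<xi> \<le> M"
proof (rule ccontr)
  assume "\<not> norm \<xi> \<le> M"
  then have gt: "norm \<xi> > M" by simp
  then have pos: "norm \<xi> > 0" using lipschitz_on_nonneg[OF lip] by linarith
  have sub: "F y + \<xi> \<bullet> (z - y) - e \<le> F z" for z
    using \<xi> by (simp add: eps_subdifferential_real_iff)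
  have e: "e \<ge> 0" using sub[of y] by simp
  \<comment> \<open>At this step length the linear growth exceeds the Lipschitz bound by e + 1.\<close>
  define s where "s = (e + 1) / (norm \<xi> * (norm \<xi> - M))"
  have s: "s > 0" using e gt pos by (simp add: s_def)
  have "F (y + s *\<^sub>R \<xi>) - F y \<le> M * norm (s *\<^sub>R \<xi>)"
    using lipschitz_on_normD[OF lip, of "y + s *\<^sub>R \<xi>" y] by simp
  then have "s * (norm \<xi> * norm \<xi>) - e \<le> s * (norm \<xi> * M)"
    using sub[of "y + s *\<^sub>R \<xi>"] s
    by (simp add: algebra_simps flip: power2_norm_eq_inner power2_eq_square)
  then have "s * (norm \<xi> * (norm \<xi> - M)) \<le> e" by (simp add: algebra_simps)
  moreover have "s * (norm \<xi> * (norm \<xi> - M)) = e + 1"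
    using gt pos by (simp add: s_def)
  ultimately show False by simp
qed

text \<open>
  A unit step in the direction of a subgradient increases P by at least the norm of the subgradient,
  and P is bounded on the compact set of points at distance at most 1 from C.
\<close>
lemma bdd_above_norm_subgradients:
  fixes P :: "'a::euclidean_space \<Rightarrow> real"
  assumes "convex_on UNIV P" "compact C"
  shows "bdd_above {norm \<xi> |\<xi> x. x \<in> C \<and> \<xi> \<in> subdifferential (ereal \<circ> P) x}"
proof -
  let ?D = "{x + u |x u. x \<in> C \<and> u \<in> cball (0::'a) 1}"
  have "continuous_on ?D P"
    using convex_on_continuous[OF open_UNIV assms(1)] continuous_on_subset by blast
  moreover have "compact ?D" using assms(2) by (intro compact_sums compact_cball)
  ultimately have "compact (P ` ?D)" by (rule compact_continuous_image)
  then have "bounded (P ` ?D)" by (rule compact_imp_bounded)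
  then obtain B where bound: "\<forall>v\<in>P ` ?D. norm v \<le> B"
    unfolding bounded_iff by (rule exE)
  have B: "\<bar>P (x + u)\<bar> \<le> B" if "x \<in> C" "norm u \<le> 1" for x u
  proof -
    have "x + u \<in> ?D" using that by auto
    then have "norm (P (x + u)) \<le> B" using bound by (rule bspec[OF _ imageI, rotated])
    then show ?thesis by simp
  qed
  have "norm \<xi> \<le> 2 * B" if "x \<in> C" "\<xi> \<in> subdifferential (ereal \<circ> P) x" for \<xi> x
  proof -
    have "norm \<xi> = \<xi> \<bullet> sgn \<xi>"
      by (cases "\<xi> = 0") (simp_all add: sgn_div_norm power2_eq_square flip: power2_norm_eq_inner)
    also have "\<dots> \<le> P (x + sgn \<xi>) - P x"
      using that(2)[unfolded subdifferential_real_iff, rule_format, of "x + sgn \<xi>"] by simp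
    also have "\<dots> \<le> 2 * B"
    proof -
      have "norm (sgn \<xi>) \<le> 1" by (simp add: norm_sgn)
      from B[OF that(1) this] B[OF that(1), of 0] show ?thesis by simp
    qed
    finally show ?thesis .
  qed
  then show ?thesis by (intro bdd_aboveI[where M = "2 * B"]) auto
qed

lemma norm_subgradient_le_sup:
  fixes P :: "'a::euclidean_space \<Rightarrow> real"
  assumes "convex_on UNIV P" "compact C" "x \<in> C" "\<xi> \<in> subdifferential (ereal \<circ> P) x"
  shows "norm \<xi> \<le> sup_subgradient_norm P C"
  unfolding sup_subgradient_norm_def
  using assms by (intro cSup_upper bdd_above_norm_subgradients) auto

text \<open>
  This is the subdifferential sum rule for F plus the indicator function of C, in the form of an optimality
  condition. A hyperplane separates the epigraph of F from the part below the graph of the affine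
  function over C; it is not vertical, because the epigraph projects onto the whole space, and its slope is p.
\<close>
lemma constrained_minimum_subgradient:
  fixes F :: "'a::euclidean_space \<Rightarrow> real"
  assumes F: "convex_on UNIV F" and C: "convex C" "x \<in> C"
    and min: "\<And>z. z \<in> C \<Longrightarrow> F x \<le> F z + w \<bullet> (z - x)"
  obtains p where "p \<in> subdifferential (ereal \<circ> F) x"
    and "\<And>z. z \<in> C \<Longrightarrow> 0 \<le> (p + w) \<bullet> (z - x)"
proof -
  define T where "T = {(z, r). z \<in> C \<and> r < F x - w \<bullet> (z - x)}"
  have "convex T"
  proof (rule convexI)
    fix a b and u v :: real
    assume "a \<in> T" "b \<in> T" and uv: "0 \<le> u" "0 \<le> v" "u + v = 1"
    then obtain z r z' r' where ab: "a = (z, r)" "b = (z', r')" "z \<in> C" "z' \<in> C"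
      "r < F x - w \<bullet> (z - x)" "r' < F x - w \<bullet> (z' - x)" by (auto simp: T_def)
    have "u * r + v * r' < u * (F x - w \<bullet> (z - x)) + v * (F x - w \<bullet> (z' - x))"
      using ab uv by (cases "u = 0")
        (auto intro!: add_less_le_mono mult_strict_left_mono mult_left_mono)
    also have "\<dots> = (u + v) * (F x + w \<bullet> x) - w \<bullet> (u *\<^sub>R z + v *\<^sub>R z')"
      by (simp add: algebra_simps)
    also have "\<dots> = F x - w \<bullet> (u *\<^sub>R z + v *\<^sub>R z' - x)"
      using uv by (simp add: algebra_simps)
    finally show "u *\<^sub>R a + v *\<^sub>R b \<in> T"
      using convexD[OF C(1) ab(3,4) uv] ab by (simp add: T_def)
  qed
  moreover have "convex (epigraph UNIV F)" using F by (rule convex_epigraphI)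
  moreover have "epigraph UNIV F \<inter> T = {}"
    using min by (fastforce simp: T_def mem_epigraph)
  moreover have "epigraph UNIV F \<noteq> {}" by (auto simp: epigraph_def)
  moreover have "T \<noteq> {}" using C by (auto simp: T_def intro!: exI[of _ x] lt_ex)
  ultimately obtain ab \<beta> where sep: "ab \<noteq> 0"
    "\<forall>q\<in>epigraph UNIV F. ab \<bullet> q \<le> \<beta>" "\<forall>q\<in>T. \<beta> \<le> ab \<bullet> q"
    using separating_hyperplane_sets[of "epigraph UNIV F" T] by metis
  obtain a b where ab: "ab = (a, b)" by fastforce
  have nz: "(a, b) \<noteq> 0" using sep(1) ab by simp
  have up: "a \<bullet> z + b * r \<le> \<beta>" if "F z \<le> r" for z r
    using sep(2)[rule_format, of "(z, r)"] that by (simp add: ab mem_epigraph)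
  have lo: "\<beta> \<le> a \<bullet> z + b * r" if "z \<in> C" "r < F x - w \<bullet> (z - x)" for z r
    using sep(3)[rule_format, of "(z, r)"] that by (simp add: ab T_def)
  have "b \<le> 0"
    using up[of x "F x + 1"] lo[of x "F x - 1"] C by (simp add: algebra_simps)
  moreover have "b \<noteq> 0"
  proof
    assume b: "b = 0"
    have "\<beta> \<le> a \<bullet> x" using lo[of x "F x - 1"] C b by simp
    moreover have "a \<bullet> (x + a) \<le> \<beta>" using up[of "x + a" "F (x + a)"] b by simp
    ultimately have "a \<bullet> a \<le> 0" by (simp add: inner_add_right)
    then have "a = 0" by (metis inner_eq_zero_iff inner_ge_zero order_antisym)
    then show False using nz b by (simp add: zero_prod_def)
  qed
  ultimately have b: "b < 0" by simp
  \<comment> \<open>The supremum of the heights in T is not attained; the term e / b descends strictly below it.\<close>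
  have lo': "\<beta> \<le> a \<bullet> z + b * (F x - w \<bullet> (z - x))" if "z \<in> C" for z
  proof (rule field_le_epsilon)
    fix e :: real assume "e > 0"
    then have "\<beta> \<le> a \<bullet> z + b * (F x - w \<bullet> (z - x) + e / b)"
      using b by (intro lo that) (simp add: divide_pos_neg)
    then show "\<beta> \<le> a \<bullet> z + b * (F x - w \<bullet> (z - x)) + e"
      using b by (simp add: distrib_left)
  qed
  define p where "p = (- inverse b) *\<^sub>R a"
  have a: "a = (- b) *\<^sub>R p" using b by (simp add: p_def)
  have \<beta>: "\<beta> = a \<bullet> x + b * F x" using up[of x "F x"] lo'[OF C(2)] by simp
  show thesis
  proof
    have "F x + p \<bullet> (z - x) \<le> F z" for z
    proof -
      have "(- b) * (F x + p \<bullet> (z - x)) \<le> (- b) * F z"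
        using up[of z "F z"] unfolding \<beta> a by (simp add: algebra_simps)
      then show ?thesis using b by (simp add: mult_le_cancel_left)
    qed
    then show "p \<in> subdifferential (ereal \<circ> F) x" by (simp add: subdifferential_real_iff)
  next
    fix z assume "z \<in> C"
    from lo'[OF this] have "0 \<le> (- b) * ((p + w) \<bullet> (z - x))"
      unfolding \<beta> a by (simp add: algebra_simps)
    then show "0 \<le> (p + w) \<bullet> (z - x)" using b by (simp add: mult_le_0_iff)
  qed
qed

text \<open>
  The point x minimizes z \<mapsto> B * norm (z - x) + v \<bullet> (z - x) over C. The sum rule provides a subgradient of
  the first term, whose norm is at most B, that compensates v up to a normal vector.
\<close>
lemma infdist_normal_cone_le:
  fixes v :: "'a::euclidean_space"
  assumes C: "convex C" "x \<in> C"
    and v: "\<And>z. z \<in> C \<Longrightarrow> - (B * norm (z - x)) \<le> v \<bullet> (z - x)" and B: "B \<ge> 0"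
  shows "infdist 0 (v +o normal_cone C x) \<le> B"
proof -
  have cvx: "convex_on UNIV (\<lambda>z. B * norm (z - x))"
    using B convex_on_cmul[of B UNIV "\<lambda>z. norm (z - x)"] convex_on_dist[of UNIV x]
    by (simp add: dist_norm norm_minus_commute)
  have min: "B * norm (x - x) \<le> B * norm (z - x) + v \<bullet> (z - x)" if "z \<in> C" for z
    using v[OF that] by simp
  obtain p where p: "p \<in> subdifferential (ereal \<circ> (\<lambda>z. B * norm (z - x))) x"
    "\<And>z. z \<in> C \<Longrightarrow> 0 \<le> (p + v) \<bullet> (z - x)"
    using constrained_minimum_subgradient[OF cvx C min] by blast
  have "B-lipschitz_on UNIV (\<lambda>z. B * norm (z - x))"
  proof (rule lipschitz_onI)
    fix y z
    have "\<bar>norm (y - x) - norm (z - x)\<bar> \<le> norm (y - z)"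
      using norm_triangle_ineq3[of "y - x" "z - x"] by simp
    then show "dist (B * norm (y - x)) (B * norm (z - x)) \<le> B * dist y z"
      using B by (simp add: dist_real_def dist_norm abs_mult mult_left_mono
          flip: right_diff_distrib)
  qed (rule B)
  then have "norm p \<le> B"
    using norm_eps_subgradient_le p(1) unfolding subdifferential_def by blast
  moreover have "- (p + v) \<in> normal_cone C x"
    using p(2) C by (simp add: normal_cone_iff del: minus_add_distrib)
  then have "v + - (p + v) \<in> v +o normal_cone C x" by (rule set_plus_intro2)
  then have "- p \<in> v +o normal_cone C x" by simp
  ultimately show ?thesis using infdist_le2[of "- p" _ 0 B] by simp
qed

section \<open>Smoothing approximations\<close>

text \<open>
  The gradient inequality of the smoothed function holds for the original one up to the lower
  approximation error at y and the upper one at the other point.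
\<close>
lemma smoothing_gradient_eps_subgradient:
  fixes \<phi> :: "'a::euclidean_space \<Rightarrow> real"
  assumes sa: "smoothing_approximation \<phi> \<phi>s a1 a2 a31 a32" and m: "m > 0"
    and e: "(a31 + a32) * m \<le> e"
  shows "gradient (\<phi>s m) y \<in> eps_subdifferential e (ereal \<circ> \<phi>) y"
proof -
  have "convex_on UNIV (\<phi>s m)" "continuously_differentiable (\<phi>s m)"
    and bounds: "\<And>y. \<phi> y - a31 * m \<le> \<phi>s m y" "\<And>y. \<phi>s m y \<le> \<phi> y + a32 * m"
    using sa m by (auto simp: smoothing_approximation_def)
  then have "\<phi>s m y + gradient (\<phi>s m) y \<bullet> (z - y) \<le> \<phi>s m z" for z
    using convex_gradient_inequality gderiv_gradient_C1 by blast
  then have "\<phi> y + gradient (\<phi>s m) y \<bullet> (z - y) - e \<le> \<phi> z" for z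
    using bounds(1)[of y] bounds(2)[of z] e by (smt (verit) distrib_right)
  then show ?thesis by (simp add: eps_subdifferential_real_iff)
qed

lemma norm_smoothing_gradient_le:
  fixes \<phi> :: "'a::euclidean_space \<Rightarrow> real"
  assumes "smoothing_approximation \<phi> \<phi>s a1 a2 a31 a32" "m > 0" "M-lipschitz_on UNIV \<phi>"
  shows "norm (gradient (\<phi>s m) y) \<le> M"
  using norm_eps_subgradient_le[OF assms(3) smoothing_gradient_eps_subgradient[OF assms(1,2)]]
  by blast

lemma lipschitz_positive_part: "1-lipschitz_on UNIV (\<lambda>s::real. max s 0)"
  by (rule lipschitz_onI) (auto simp: dist_real_def max_def)

text \<open>
  By convexity the slope at s is at least the slope of the chord from 0 to s, which differs from that of
  the positive part, namely 1, by at most (a31 + a32) * m / s < 1 / 2.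
\<close>
lemma positive_part_smoothing_slope:
  assumes sa: "smoothing_approximation (\<lambda>s. max s 0) \<phi>s a1 a2 a31 a32" and m: "m > 0"
    and s: "s > 2 * (a31 + a32) * m"
  shows "gradient (\<phi>s m) s \<ge> 1 / 2"
proof -
  have a3: "a31 + a32 > 0" and "convex_on UNIV (\<phi>s m)" "continuously_differentiable (\<phi>s m)"
    and bounds: "\<And>y. max y 0 - a31 * m \<le> \<phi>s m y" "\<And>y. \<phi>s m y \<le> max y 0 + a32 * m"
    using sa m by (auto simp: smoothing_approximation_def)
  then have "\<phi>s m s + gradient (\<phi>s m) s \<bullet> (0 - s) \<le> \<phi>s m 0"
    by (intro convex_gradient_inequality gderiv_gradient_C1)
  then have tangent: "\<phi>s m s - gradient (\<phi>s m) s * s \<le> \<phi>s m 0" by simp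
  have pos: "0 < (a31 + a32) * m" using a3 m by simp
  have "2 * ((a31 + a32) * m) < s" using s by (simp only: mult.assoc)
  then have s': "s > 0" "(a31 + a32) * m < 1 / 2 * s" using pos by auto
  have "s - (a31 + a32) * m \<le> gradient (\<phi>s m) s * s"
    using tangent bounds(1)[of s] bounds(2)[of 0] s'(1) by (simp add: distrib_right)
  then have "1 / 2 * s \<le> gradient (\<phi>s m) s * s" using s'(2) by linarith
  then show ?thesis using s'(1) by (simp only: mult_le_cancel_right_pos)
qed

text \<open>
  Both factors of the gradient U are eps-subgradients of Lipschitz functions, so they are bounded by 1
  and by M; splitting the difference of the products accordingly gives the constant.
\<close>
lemma smoothing_composition:
  fixes h :: "'b::euclidean_space \<Rightarrow> real"
  assumes hs: "smoothing_approximation h hs ah1 ah2 ah31 ah32"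
    and \<phi>s: "smoothing_approximation (\<lambda>s. max s 0) \<phi>s ap1 ap2 ap31 ap32"
    and lip: "M-lipschitz_on UNIV h" and m: "m > 0"
  defines "U \<equiv> \<lambda>y. gradient (\<phi>s m) (hs m y) *\<^sub>R gradient (hs m) y"
  shows "GDERIV (\<phi>s m \<circ> hs m) y :> U y"
    and "norm (U y) \<le> M"
    and "norm (U y - U z) \<le> (ah1 + M\<^sup>2 * ap1 + (ah2 + M\<^sup>2 * ap2) / m) * norm (y - z)"
proof -
  let ?u = "gradient (hs m)" and ?p = "gradient (\<phi>s m)"
  have h: "convex_on UNIV (hs m)" "continuously_differentiable (hs m)"
      "(ah1 + ah2 / m)-lipschitz_on UNIV ?u"
    and \<phi>: "continuously_differentiable (\<phi>s m)" "(ap1 + ap2 / m)-lipschitz_on UNIV ?p"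
    using hs \<phi>s m by (auto simp: smoothing_approximation_def)
  note gh = gderiv_gradient_C1[OF h(2)] and gp = gderiv_gradient_C1[OF \<phi>(1)]
  have u: "norm (?u y) \<le> M" for y by (rule norm_smoothing_gradient_le[OF hs m lip])
  have p: "\<bar>?p s\<bar> \<le> 1" for s
    using norm_smoothing_gradient_le[OF \<phi>s m lipschitz_positive_part, of s] by simp
  have M: "M \<ge> 0" using lip lipschitz_on_nonneg by blast
  show "GDERIV (\<phi>s m \<circ> hs m) y :> U y"
    using GDERIV_DERIV_compose[OF gh, of "\<phi>s m" "?p (hs m y)" y] gp
    by (simp add: U_def o_def)
  show "norm (U y) \<le> M"
    using mult_mono[OF p u] by (simp add: U_def)
  have hlip: "\<bar>hs m y - hs m z\<bar> \<le> M * norm (y - z)" for y z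
  proof -
    have "hs m y - hs m z \<le> M * norm (y - z)" for y z
    proof -
      have "hs m y - hs m z \<le> ?u y \<bullet> (y - z)"
        using convex_gradient_inequality[OF h(1) gh, of y z] by (simp add: algebra_simps)
      also have "\<dots> \<le> norm (?u y) * norm (y - z)" by (rule norm_cauchy_schwarz)
      also have "\<dots> \<le> M * norm (y - z)" using u by (intro mult_right_mono) auto
      finally show ?thesis .
    qed
    from this[of y z] this[of z y] show ?thesis by (simp add: norm_minus_commute)
  qed
  have lip_nonneg: "ap1 + ap2 / m \<ge> 0" using \<phi>(2) lipschitz_on_nonneg by blast
  have "U y - U z = ?p (hs m y) *\<^sub>R (?u y - ?u z) + (?p (hs m y) - ?p (hs m z)) *\<^sub>R ?u z"
    by (simp add: U_def algebra_simps)
  then have "norm (U y - U z)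
      \<le> \<bar>?p (hs m y)\<bar> * norm (?u y - ?u z) + \<bar>?p (hs m y) - ?p (hs m z)\<bar> * norm (?u z)"
    by (metis norm_scaleR norm_triangle_ineq)
  also have "\<dots> \<le> 1 * ((ah1 + ah2 / m) * norm (y - z))
      + ((ap1 + ap2 / m) * (M * norm (y - z))) * M"
  proof (intro add_mono mult_mono)
    have "\<bar>?p (hs m y) - ?p (hs m z)\<bar> \<le> (ap1 + ap2 / m) * \<bar>hs m y - hs m z\<bar>"
      using lipschitz_on_normD[OF \<phi>(2), of "hs m y" "hs m z"] by simp
    also have "\<dots> \<le> (ap1 + ap2 / m) * (M * norm (y - z))"
      using hlip lip_nonneg by (intro mult_left_mono)
    finally show "\<bar>?p (hs m y) - ?p (hs m z)\<bar> \<le> (ap1 + ap2 / m) * (M * norm (y - z))" .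
  qed (use p u M lip_nonneg lipschitz_on_normD[OF h(3)] in auto)
  also have "\<dots> = (ah1 + M\<^sup>2 * ap1 + (ah2 + M\<^sup>2 * ap2) / m) * norm (y - z)"
    by (simp add: algebra_simps add_divide_distrib power2_eq_square)
  finally show "norm (U y - U z)
      \<le> (ah1 + M\<^sup>2 * ap1 + (ah2 + M\<^sup>2 * ap2) / m) * norm (y - z)" .
qed

lemma gderiv_compose_adjoint:
  fixes F :: "'a::euclidean_space \<Rightarrow> 'b::euclidean_space"
  assumes D: "(F has_derivative D) (at x)" and H: "GDERIV H (F x) :> u"
  shows "GDERIV (H \<circ> F) x :> adjoint D u"
proof -
  have "((\<lambda>x. H (F x)) has_derivative (\<lambda>v. D v \<bullet> u)) (at x)"
    using has_derivative_compose[OF D H[unfolded gderiv_def]] .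
  then show ?thesis
    using adjoint_works[OF has_derivative_linear[OF D], of _ u]
    by (simp add: gderiv_def o_def)
qed

text \<open>
  The derivative of F at y is applied only to the direction z - y, along which it is bounded by M',
  although F is M'-Lipschitz only on C.
\<close>
lemma composition_gradient_lipschitz_feasible:
  fixes F :: "'a::euclidean_space \<Rightarrow> 'b::euclidean_space"
  assumes C: "convex C" "x \<in> C" "y \<in> C" "z \<in> C"
    and F: "continuously_differentiable F" "smooth_on L C F" "M'-lipschitz_on C F"
    and U: "\<And>y. norm (U y) \<le> M" "\<And>y z. norm (U y - U z) \<le> K * norm (y - z)" "K \<ge> 0"
  shows "\<bar>(adjoint (fderiv F x) (U (F x)) - adjoint (fderiv F y) (U (F y))) \<bullet> (z - y)\<bar>
    \<le> (M * L + K * M'\<^sup>2) * norm (x - y) * norm (z - y)"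
proof -
  let ?D = "fderiv F" and ?w = "z - y"
  have adj: "adjoint (?D x) u \<bullet> w = u \<bullet> ?D x w" for x u w
    using adjoint_works[of "?D x" w u]
    by (simp add: inner_commute blinfun.bounded_linear_right bounded_linear.linear)
  have L: "norm (?D x - ?D y) \<le> L * norm (x - y)"
    using F(2) C lipschitz_on_normD unfolding smooth_on_def by blast
  have M': "norm (F x - F y) \<le> M' * norm (x - y)"
    using F(3) C lipschitz_on_normD by blast
  have M'0: "M' \<ge> 0" and L0: "L \<ge> 0"
    using F(2,3) lipschitz_on_nonneg unfolding smooth_on_def by blast+
  have M0: "M \<ge> 0" using U(1) norm_ge_zero order_trans by blast
  have dir: "norm (?D y ?w) \<le> M' * norm ?w"
    by (rule norm_derivative_feasible_direction[OF C(1,3,4) F(3) has_derivative_fderiv[OF F(1)]])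
  have "(adjoint (?D x) (U (F x)) - adjoint (?D y) (U (F y))) \<bullet> ?w
      = U (F x) \<bullet> ?D x ?w - U (F y) \<bullet> ?D y ?w"
    by (simp only: inner_diff_left adj)
  also have "\<dots> = U (F x) \<bullet> (?D x - ?D y) ?w + (U (F x) - U (F y)) \<bullet> ?D y ?w"
    by (simp only: inner_diff_left inner_diff_right blinfun.diff_left)
  finally have "\<bar>(adjoint (?D x) (U (F x)) - adjoint (?D y) (U (F y))) \<bullet> ?w\<bar>
      \<le> norm (U (F x)) * norm ((?D x - ?D y) ?w) + norm (U (F x) - U (F y)) * norm (?D y ?w)"
    using Cauchy_Schwarz_ineq2[of "U (F x)" "(?D x - ?D y) ?w"]
      Cauchy_Schwarz_ineq2[of "U (F x) - U (F y)" "?D y ?w"] by linarith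
  also have "\<dots> \<le> M * ((L * norm (x - y)) * norm ?w)
      + (K * (M' * norm (x - y))) * (M' * norm ?w)"
  proof (intro add_mono mult_mono)
    show "norm ((?D x - ?D y) ?w) \<le> L * norm (x - y) * norm ?w"
      using norm_blinfun[of "?D x - ?D y" ?w] mult_right_mono[OF L norm_ge_zero[of ?w]]
      by linarith
    show "norm (U (F x) - U (F y)) \<le> K * (M' * norm (x - y))"
      using U(2)[of "F x" "F y"] mult_left_mono[OF M' U(3)] by linarith
  qed (use U dir M0 M'0 L0 in auto)
  also have "\<dots> = (M * L + K * M'\<^sup>2) * norm (x - y) * norm ?w"
    by (simp add: algebra_simps power2_eq_square)
  finally show ?thesis .
qed

section \<open>One iteration of the algorithm\<close>

text \<open>
  Along the segment from y to z the objective of the subproblem grows by at most s * V + K * s^2 for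
  s \<in> {0<..1}, where V is the slack of the claimed inequality; so V cannot be negative.
\<close>
lemma subproblem_minimizer:
  fixes P1 :: "'a::euclidean_space \<Rightarrow> real"
  assumes C: "convex C" "xk \<in> C" and P1: "convex_on UNIV P1" and \<gamma>: "\<gamma> \<ge> 0"
    and argmin: "is_arg_min (subproblem_objective f P1 C G xk \<xi> \<gamma> \<mu> L) (\<lambda>_. True) y"
  shows "y \<in> C"
    and "z \<in> C \<Longrightarrow> \<gamma> * P1 y \<le> \<gamma> * P1 z +
      (\<gamma> *\<^sub>R (gradient f xk - \<xi>) + gradient G xk + (L / \<mu>) *\<^sub>R (y - xk)) \<bullet> (z - y)"
proof -
  define a where "a = gradient f xk - \<xi>"
  define b where "b = gradient G xk"
  define Q where "Q = (\<lambda>z. \<gamma> * (a \<bullet> z + P1 z) + (G xk + b \<bullet> (z - xk))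
    + L / (2 * \<mu>) * (norm (z - xk))\<^sup>2)"
  have obj: "subproblem_objective f P1 C G xk \<xi> \<gamma> \<mu> L z = (if z \<in> C then ereal (Q z) else \<infinity>)"
    for z by (simp add: subproblem_objective_def ind_fun_def Q_def a_def b_def)
  have min: "\<not> subproblem_objective f P1 C G xk \<xi> \<gamma> \<mu> L z
      < subproblem_objective f P1 C G xk \<xi> \<gamma> \<mu> L y" for z
    using argmin by (simp add: is_arg_min_def)
  show y: "y \<in> C" using min[of xk] C(2) by (auto simp: obj split: if_splits)
  assume z: "z \<in> C"
  define v where "v = z - y"
  define V where "V = \<gamma> * (P1 z - P1 y) + (\<gamma> *\<^sub>R a + b + (L / \<mu>) *\<^sub>R (y - xk)) \<bullet> v"
  define K where "K = L / (2 * \<mu>) * (norm v)\<^sup>2"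
  \<comment> \<open>The parabola - K * s^2 stays below the line V * s and has derivative 0 at 0.\<close>
  have "0 \<le> V"
  proof (rule derivative_le_of_right_bound[where q = "\<lambda>s. - K * s\<^sup>2"])
    show "((\<lambda>s. - K * s\<^sup>2) has_real_derivative 0) (at 0)"
      by (auto intro!: derivative_eq_intros)
  next
    fix s :: real
    assume s: "0 < s" "s \<le> 1"
    let ?y = "y + s *\<^sub>R v"
    have "?y \<in> C" using convex_segment_mem[OF C(1) y z] s by (simp add: v_def)
    then have "Q y \<le> Q ?y" using min[of ?y] y by (simp add: obj)
    moreover have "P1 ?y \<le> P1 y + s * (P1 z - P1 y)"
      using convex_onD[OF P1, of s y z] s by (simp add: v_def algebra_simps)
    then have "\<gamma> * P1 ?y \<le> \<gamma> * (P1 y + s * (P1 z - P1 y))"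
      using \<gamma> by (rule mult_left_mono)
    moreover have nrm: "(norm (?y - xk))\<^sup>2
        = (norm (y - xk))\<^sup>2 + 2 * s * ((y - xk) \<bullet> v) + s\<^sup>2 * (norm v)\<^sup>2"
      unfolding power2_norm_eq_inner by (simp add: algebra_simps power2_eq_square inner_commute)
    have "L / (2 * \<mu>) * (norm (?y - xk))\<^sup>2
        = L / (2 * \<mu>) * (norm (y - xk))\<^sup>2 + s * (L / \<mu> * ((y - xk) \<bullet> v)) + K * s\<^sup>2"
      unfolding nrm K_def by (simp add: distrib_left ac_simps)
    moreover have "b \<bullet> (?y - xk) = b \<bullet> (y - xk) + s * (b \<bullet> v)"
      by (simp add: algebra_simps)
    moreover have "\<gamma> * (a \<bullet> ?y + P1 ?y) = \<gamma> * (a \<bullet> y) + s * (\<gamma> * (a \<bullet> v)) + \<gamma> * P1 ?y"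
      by (simp add: algebra_simps)
    moreover have "s * V = s * (\<gamma> * (P1 z - P1 y)) + s * (\<gamma> * (a \<bullet> v)) + s * (b \<bullet> v)
        + s * (L / \<mu> * ((y - xk) \<bullet> v))"
      by (simp add: V_def inner_add_left distrib_left)
    ultimately have "0 \<le> s * V + K * s\<^sup>2"
      unfolding Q_def by (simp add: distrib_left mult.left_commute)
    then show "- K * s\<^sup>2 \<le> - K * 0\<^sup>2 + V * s" by (simp add: mult.commute)
  qed
  then show "\<gamma> * P1 y \<le> \<gamma> * P1 z +
      (\<gamma> *\<^sub>R (gradient f xk - \<xi>) + gradient G xk + (L / \<mu>) *\<^sub>R (y - xk)) \<bullet> (z - y)"
    by (simp add: V_def v_def a_def b_def right_diff_distrib)
qed

text \<open>
  At z = xk the optimality condition contributes L / \<mu> times the squared step, twice the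
  proximal term, which is the gain from strong convexity. Hence L needs to dominate only half of
  the curvature bound.
\<close>
lemma sufficient_descent_of_large_constant:
  fixes P1 :: "'a::euclidean_space \<Rightarrow> real"
  assumes C: "xk \<in> C" "y \<in> C" and pos: "\<gamma> \<ge> 0" "\<mu> > 0"
    and vi: "\<gamma> * P1 y \<le> \<gamma> * P1 xk +
      (\<gamma> *\<^sub>R (gradient f xk - \<xi>) + gradient G xk + (L / \<mu>) *\<^sub>R (y - xk)) \<bullet> (xk - y)"
    and \<xi>: "\<xi> \<in> subdifferential (ereal \<circ> P2) xk"
    and f: "f y \<le> f xk + gradient f xk \<bullet> (y - xk) + Lf / 2 * (norm (y - xk))\<^sup>2"
    and G: "G y \<le> G xk + gradient G xk \<bullet> (y - xk) + LG / 2 * (norm (y - xk))\<^sup>2"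
    and L: "c1 + \<gamma> * \<mu> * Lf + \<mu> * LG \<le> 2 * L"
  shows "sufficient_descent (objective f P1 P2 C) G c1 \<gamma> \<mu> xk y"
proof -
  let ?d = "y - xk"
  let ?n = "(norm ?d)\<^sup>2"
  have "P2 xk + \<xi> \<bullet> ?d \<le> P2 y" using \<xi> by (simp add: subdifferential_real_iff)
  then have "\<gamma> * (P2 xk + \<xi> \<bullet> ?d) \<le> \<gamma> * P2 y" using pos(1) by (rule mult_left_mono)
  moreover have "\<gamma> * f y \<le> \<gamma> * (f xk + gradient f xk \<bullet> ?d + Lf / 2 * ?n)"
    using f pos(1) by (rule mult_left_mono)
  moreover have "(\<gamma> *\<^sub>R (gradient f xk - \<xi>) + gradient G xk + (L / \<mu>) *\<^sub>R ?d) \<bullet> (xk - y)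
      = - (\<gamma> * (gradient f xk \<bullet> ?d)) + \<gamma> * (\<xi> \<bullet> ?d) - gradient G xk \<bullet> ?d - L / \<mu> * ?n"
    by (simp add: power2_norm_eq_inner algebra_simps)
  moreover have "c1 / (2 * \<mu>) + \<gamma> * Lf / 2 + LG / 2 \<le> L / \<mu>"
    using divide_right_mono[OF L, of "2 * \<mu>"] pos(2) by (simp add: add_divide_distrib)
  then have "(c1 / (2 * \<mu>) + \<gamma> * Lf / 2 + LG / 2) * ?n \<le> L / \<mu> * ?n"
    by (rule mult_right_mono) simp
  ultimately have "\<gamma> * (f y + P1 y - P2 y) + G y
      \<le> \<gamma> * (f xk + P1 xk - P2 xk) + G xk - c1 / (2 * \<mu>) * ?n"
    using vi G by (simp add: distrib_left distrib_right right_diff_distrib)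
  then show ?thesis
    using C by (simp add: sufficient_descent_def objective_def ind_fun_def)
qed

text \<open>
  The last rejected constant is half of the accepted one.
\<close>
lemma backtracking_constant_le:
  fixes L0 :: real
  assumes "L0 \<le> Lmax" and "\<And>i. i < j \<Longrightarrow> 2 * (2 ^ i * L0) < K"
  shows "2 ^ j * L0 \<le> max Lmax K"
  using assms(1) assms(2)[of "j - 1"] by (cases j) (auto simp: max_def mult.assoc)

text \<open>
  The sum rule splits the optimality condition of the subproblem into a subgradient of P1 and a normal
  vector. Every term other than the constraint gradient at y is then bounded by its norm.
\<close>
lemma constraint_gradient_residual:
  fixes P1 :: "'a::euclidean_space \<Rightarrow> real"
  assumes C: "convex C" "y \<in> C" and P1: "convex_on UNIV P1"
    and pos: "\<gamma> > 0" "\<mu> > 0" "L \<ge> 0"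
    and vi: "\<And>z. z \<in> C \<Longrightarrow> \<gamma> * P1 y \<le> \<gamma> * P1 z +
      (\<gamma> *\<^sub>R (gradient f xk - \<xi>) + gradient G xk + (L / \<mu>) *\<^sub>R (y - xk)) \<bullet> (z - y)"
    and G: "\<And>z. z \<in> C \<Longrightarrow>
      \<bar>(gradient G xk - gradient G y) \<bullet> (z - y)\<bar> \<le> LG * norm (xk - y) * norm (z - y)"
    and bounds: "norm (gradient f xk) \<le> Mf" "norm \<xi> \<le> M2"
      "\<And>p. p \<in> subdifferential (ereal \<circ> P1) y \<Longrightarrow> norm p \<le> M1"
    and z: "z \<in> C"
  shows "- ((\<gamma> * (Mf + M1 + M2) + (L / \<mu> + LG) * norm (y - xk)) * norm (z - y))
    \<le> gradient G y \<bullet> (z - y)"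
proof -
  define w where "w = \<gamma> *\<^sub>R (gradient f xk - \<xi>) + gradient G xk + (L / \<mu>) *\<^sub>R (y - xk)"
  \<comment> \<open>Dividing by the penalty isolates P1, so that the sum rule yields a subgradient of P1 itself.\<close>
  have "P1 y \<le> P1 z + (inverse \<gamma> *\<^sub>R w) \<bullet> (z - y)" if "z \<in> C" for z
  proof -
    have "\<gamma> * P1 y \<le> \<gamma> * (P1 z + (inverse \<gamma> *\<^sub>R w) \<bullet> (z - y))"
      using vi[OF that] pos(1) by (simp add: w_def[symmetric] distrib_left flip: mult.assoc)
    then show ?thesis using pos(1) by (simp only: mult_le_cancel_left_pos)
  qed
  then obtain p where p: "p \<in> subdifferential (ereal \<circ> P1) y"
    "\<And>z. z \<in> C \<Longrightarrow> 0 \<le> (p + inverse \<gamma> *\<^sub>R w) \<bullet> (z - y)"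
    using constrained_minimum_subgradient[OF P1 C] by blast
  let ?n = "norm (z - y)"
  define e where "e = gradient f xk - \<xi> + p"
  have "0 \<le> \<gamma> * ((p + inverse \<gamma> *\<^sub>R w) \<bullet> (z - y))" using p(2)[OF z] pos(1) by simp
  also have "\<dots> = (\<gamma> *\<^sub>R p + w) \<bullet> (z - y)" using pos(1) by (simp add: inner_add_left distrib_left)
  also have "\<dots> = \<gamma> * (e \<bullet> (z - y)) + (gradient G xk - gradient G y) \<bullet> (z - y)
      + gradient G y \<bullet> (z - y) + L / \<mu> * ((y - xk) \<bullet> (z - y))"
    by (simp add: w_def e_def inner_add_left inner_diff_left distrib_left right_diff_distrib)
  also have "\<dots> \<le> \<gamma> * ((Mf + M1 + M2) * ?n) + LG * norm (y - xk) * ?n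
      + gradient G y \<bullet> (z - y) + L / \<mu> * (norm (y - xk) * ?n)"
  proof (intro add_mono mult_left_mono)
    have "norm e \<le> Mf + M1 + M2"
      using norm_triangle_ineq[of "gradient f xk - \<xi>" p]
        norm_triangle_ineq4[of "gradient f xk" \<xi>] bounds(1,2) bounds(3)[OF p(1)]
      by (simp add: e_def)
    then have "norm e * ?n \<le> (Mf + M1 + M2) * ?n" by (rule mult_right_mono) simp
    then show "e \<bullet> (z - y) \<le> (Mf + M1 + M2) * ?n"
      using norm_cauchy_schwarz[of e "z - y"] by linarith
    show "(gradient G xk - gradient G y) \<bullet> (z - y) \<le> LG * norm (y - xk) * ?n"
      using G[OF z] by (simp add: norm_minus_commute)
  qed (use pos in \<open>auto simp: norm_cauchy_schwarz\<close>)
  finally show ?thesis by (simp add: algebra_simps)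
qed

text \<open>
  The slope of the smoothed positive part is at least 1 / 2, so a residual bound B for the
  gradient of the smoothed constraint gives the bound 2 * B for the vector v that the constraint
  qualification keeps away from the negative normal cone.
\<close>
lemma regularity_bounds_residual:
  fixes c :: "'a::euclidean_space \<Rightarrow> 'b::euclidean_space"
  assumes C: "convex C" "y \<in> C" and c: "continuously_differentiable c"
    and hs: "smoothing_approximation h hs ah1 ah2 ah31 ah32"
    and \<phi>s: "smoothing_approximation (\<lambda>s. max s 0) \<phi>s ap1 ap2 ap31 ap32"
    and lip: "M-lipschitz_on UNIV h" and m: "m > 0"
    and small: "(ah31 + ah32) * m \<le> \<eta>" "max ah32 0 * m \<le> \<eta>"
    and infeasible: "hs m (c y) > 2 * (ap31 + ap32) * m"
    and residual: "\<And>z. z \<in> C \<Longrightarrow>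
      - (B * norm (z - y)) \<le> gradient (smooth_constraint \<phi>s hs c m) y \<bullet> (z - y)"
    and B: "B \<ge> 0"
    and regular: "\<And>u. h (c y) \<ge> - \<eta> \<Longrightarrow> u \<in> eps_subdifferential \<eta> (ereal \<circ> h) (c y) \<Longrightarrow>
      infdist 0 (adjoint (fderiv c y) u +o normal_cone C y) \<ge> \<eta>"
  shows "\<eta> \<le> 2 * B"
proof -
  let ?u = "gradient (hs m) (c y)"
  define \<theta> where "\<theta> = gradient (\<phi>s m) (hs m (c y))"
  define v where "v = adjoint (fderiv c y) ?u"
  have \<theta>: "\<theta> \<ge> 1 / 2"
    unfolding \<theta>_def using positive_part_smoothing_slope[OF \<phi>s m infeasible] .
  note D = has_derivative_fderiv[OF c, of y]
  have "gradient (smooth_constraint \<phi>s hs c m) y = adjoint (fderiv c y) (\<theta> *\<^sub>R ?u)"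
    unfolding smooth_constraint_def \<theta>_def
    by (rule gradient_unique[OF gderiv_compose_adjoint[OF D smoothing_composition(1)[OF hs \<phi>s lip m]]])
  also have "\<dots> = \<theta> *\<^sub>R v"
    unfolding v_def by (rule linear_cmul[OF adjoint_linear[OF has_derivative_linear[OF D]]])
  finally have grad: "gradient (smooth_constraint \<phi>s hs c m) y = \<theta> *\<^sub>R v" .
  \<comment> \<open>Where v has a negative inner product, the slope bound 1 / 2 applies; elsewhere the claim is trivial.\<close>
  have "- (2 * B * norm (z - y)) \<le> v \<bullet> (z - y)" if "z \<in> C" for z
  proof (cases "v \<bullet> (z - y) \<ge> 0")
    case True
    then show ?thesis using B by (simp add: order_trans[of _ 0])
  next
    case False
    then have "\<theta> * (v \<bullet> (z - y)) \<le> 1 / 2 * (v \<bullet> (z - y))"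
      using \<theta> by (intro mult_right_mono_neg) auto
    then show ?thesis using residual[OF that] by (simp add: grad)
  qed
  then have "infdist 0 (v +o normal_cone C y) \<le> 2 * B"
    using B C by (intro infdist_normal_cone_le) auto
  moreover have "\<eta> \<le> infdist 0 (v +o normal_cone C y)"
    unfolding v_def
  proof (rule regular)
    show "?u \<in> eps_subdifferential \<eta> (ereal \<circ> h) (c y)"
      using hs m small(1) by (rule smoothing_gradient_eps_subgradient)
    have "0 < (ap31 + ap32) * m" using \<phi>s m by (simp add: smoothing_approximation_def)
    then have "0 < hs m (c y)" using infeasible by (simp only: mult.assoc)
    moreover have "hs m (c y) \<le> h (c y) + ah32 * m"
      using hs m by (simp add: smoothing_approximation_def)
    moreover have "ah32 * m \<le> max ah32 0 * m" using m by (intro mult_right_mono) auto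
    ultimately show "- \<eta> \<le> h (c y)" using small(2) by linarith
  qed
  ultimately show ?thesis by linarith
qed

section \<open>Counting the reductions of the penalty parameter\<close>

lemma step_counter_le: 
  fixes t :: "nat \<Rightarrow> nat"
  assumes "t 0 = 0" "\<And>k. t (Suc k) = t k \<or> t (Suc k) = t k + 1"
  shows "t k \<le> k"
proof (induction k)
  case (Suc k)
  then show ?case using assms(2)[of k] by auto
qed (simp add: assms(1))

text \<open>
  The counter takes distinct values below N at the steps where it changes.
\<close>
lemma card_step_counter_changes:
  fixes t :: "nat \<Rightarrow> nat"
  assumes step: "\<And>k. t (Suc k) = t k \<or> t (Suc k) = t k + 1" and bound: "\<And>k. t k \<le> N"
  shows "finite {k. t (Suc k) \<noteq> t k} \<and> card {k. t (Suc k) \<noteq> t k} \<le> N"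
proof -
  let ?I = "{k. t (Suc k) \<noteq> t k}"
  have "t k \<le> t (Suc k)" for k using step[of k] by linarith
  then have mono: "incseq t" by (rule incseq_SucI)
  have "t k \<noteq> t l" if "k < l" "k \<in> ?I" for k l
    using that step[of k] incseqD[OF mono, of "Suc k" l] by auto
  then have inj: "inj_on t ?I" by (intro linorder_inj_onI) auto
  have "t k < N" if "t (Suc k) \<noteq> t k" for k
    using step[of k] bound[of "Suc k"] that by linarith
  then have sub: "t ` ?I \<subseteq> {..<N}" by auto
  then have "finite ?I" using inj finite_imageD[of t ?I] finite_subset[of "t ` ?I"] by simp
  moreover have "card ?I \<le> N"
    using card_inj_on_le[OF inj sub] by simp
  ultimately show ?thesis ..
qed

text \<open>
  A reduction at a step k \<ge> k0 starts from at least M * e and loses at most the factor M. The first k0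
  steps cannot push the counter beyond k0.
\<close>
lemma penalty_parameter_lower_bound:
  fixes \<gamma>hat :: "nat \<Rightarrow> real" and t :: "nat \<Rightarrow> nat"
  assumes anti: "antimono \<gamma>hat" and ratio: "M > 0" "\<And>s. \<gamma>hat s \<le> M * \<gamma>hat (Suc s)"
    and t: "t 0 = 0" "\<And>k. t (Suc k) = t k \<or> t (Suc k) = t k + 1"
    and large: "\<And>k. k \<ge> k0 \<Longrightarrow> t (Suc k) \<noteq> t k \<Longrightarrow> M * e \<le> \<gamma>hat (t k)"
  shows "min e (\<gamma>hat (k0 + 1)) \<le> \<gamma>hat (t k)"
proof (induction k)
  case 0
  then show ?case using antimonoD[OF anti, of 0 "k0 + 1"] t(1) by (simp add: min.coboundedI2)
next
  case (Suc k)
  consider "t (Suc k) = t k" | "t (Suc k) \<noteq> t k" "k \<ge> k0" | "k < k0" by linarith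
  then show ?case
  proof cases
    case 1
    then show ?thesis using Suc by simp
  next
    case 2
    then have "M * e \<le> M * \<gamma>hat (t (Suc k))"
      using large[of k] ratio(2)[of "t k"] t(2)[of k] by auto
    then show ?thesis using ratio(1) by (simp add: min.coboundedI1)
  next
    case 3
    then have "t (Suc k) \<le> k0 + 1" using step_counter_le[OF t, of "Suc k"] by linarith
    then show ?thesis using antimonoD[OF anti] by (simp add: min.coboundedI2)
  qed
qed

section \<open>The lower bound for the penalty parameter\<close>

theorem theorem3p1:
  fixes f P1 P2 :: "'a::euclidean_space \<Rightarrow> real"
    and C :: "'a set"
    and c :: "'a \<Rightarrow> 'b::euclidean_space"
    and h :: "'b \<Rightarrow> real"
    and hs :: "real \<Rightarrow> 'b \<Rightarrow> real"
    and \<phi>s :: "real \<Rightarrow> real \<Rightarrow> real"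
    and L\<^sub>f L\<^sub>c M\<^sub>c M\<^sub>h :: real
    and \<alpha>h1 \<alpha>h2 \<alpha>h31 \<alpha>h32 \<alpha>h4 \<alpha>\<phi>1 \<alpha>\<phi>2 \<alpha>\<phi>31 \<alpha>\<phi>32 \<alpha>\<phi>4 :: real
    and Lmin Lmax c1 c2 M\<gamma> \<eta>1 :: real
    and \<gamma>hat \<mu> \<gamma> :: "nat \<Rightarrow> real"
    and x :: "nat \<Rightarrow> 'a"
    and t :: "nat \<Rightarrow> nat"
  assumes C: "compact C" "convex C" "{z \<in> C. h (c z) \<le> 0} \<noteq> {}"
    and f: "continuously_differentiable f" "L\<^sub>f > 0" "smooth_on L\<^sub>f C f"
    and c: "continuously_differentiable c" "L\<^sub>c \<ge> 0" "smooth_on L\<^sub>c C c"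
           "M\<^sub>c > 0" "M\<^sub>c-lipschitz_on C c"
    and P: "convex_on UNIV P1" "convex_on UNIV P2"
    and h: "convex_on UNIV h" "M\<^sub>h > 0" "M\<^sub>h-lipschitz_on UNIV h"
    and hs: "smoothing_approximation h hs \<alpha>h1 \<alpha>h2 \<alpha>h31 \<alpha>h32" "\<alpha>h4 \<ge> 0"
            "\<And>m0 m1 y. m0 \<ge> m1 \<Longrightarrow> m1 > 0 \<Longrightarrow> hs m1 y \<le> hs m0 y + \<alpha>h4 * (m0 - m1)"
    and \<phi>s: "smoothing_approximation (\<lambda>s. max s 0) \<phi>s \<alpha>\<phi>1 \<alpha>\<phi>2 \<alpha>\<phi>31 \<alpha>\<phi>32" "\<alpha>\<phi>4 \<ge> 0"
            "\<And>m0 m1 s. m0 \<ge> m1 \<Longrightarrow> m1 > 0 \<Longrightarrow> \<phi>s m1 s \<le> \<phi>s m0 s + \<alpha>\<phi>4 * (m0 - m1)"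
    and alg: "sESQM f P1 P2 C c hs \<phi>s (\<alpha>\<phi>31 + \<alpha>\<phi>32) Lmin Lmax c1 c2 \<gamma>hat x \<mu> t \<gamma>"
    and CQ: "\<And>z. z \<in> C \<Longrightarrow> h (c z) \<ge> 0 \<Longrightarrow>
               0 \<notin> limiting_subdifferential (h \<circ> c) z + normal_cone C z"
    and mu: "\<And>k. \<mu> k > 0" "decseq \<mu>" "\<mu> \<longlonglongrightarrow> 0"
            "filterlim (\<lambda>K::nat. \<Sum>k = nat \<lceil>real K / 2\<rceil>..K. \<mu> k) at_top sequentially"
    and gam: "\<gamma>hat \<longlonglongrightarrow> 0" "M\<gamma> > 1"
             "\<And>k. 0 < \<gamma>hat (Suc k) \<and> \<gamma>hat (Suc k) < \<gamma>hat k \<and> \<gamma>hat k \<le> M\<gamma> * \<gamma>hat (Suc k)"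
    and eta: "\<eta>1 > 0"
             "\<And>z u. z \<in> C \<Longrightarrow> h (c z) \<ge> - \<eta>1 \<Longrightarrow> u \<in> eps_subdifferential \<eta>1 (ereal \<circ> h) (c z) \<Longrightarrow>
                infdist 0 (adjoint (blinfun_apply (fderiv c z)) u +o normal_cone C z) \<ge> \<eta>1"
  shows "let \<alpha>1 = \<alpha>h1 + M\<^sub>h\<^sup>2 * \<alpha>\<phi>1;
             \<alpha>2 = \<alpha>h2 + M\<^sub>h\<^sup>2 * \<alpha>\<phi>2;
             L\<mu>0 = M\<^sub>h * L\<^sub>c + \<alpha>1 * M\<^sub>c\<^sup>2 + \<alpha>2 * M\<^sub>c\<^sup>2 / \<mu> 0;
             M\<^sub>L = max Lmax (c1 + \<gamma> 0 * \<mu> 0 * L\<^sub>f + \<mu> 0 * L\<mu>0);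
             M\<^sub>f = (SUP z\<in>C. norm (gradient f z));
             M\<^sub>P\<^sub>1 = sup_subgradient_norm P1 C;
             M\<^sub>P\<^sub>2 = sup_subgradient_norm P2 C;
             \<mu>small = (\<lambda>k. \<mu> k \<le> \<eta>1 / max (\<alpha>h31 + \<alpha>h32) (max \<alpha>h32 0));
             k0 = (LEAST k. \<mu>small k);
             \<eta>\<^sub>\<gamma> = min (\<eta>1 / (2 * M\<gamma> * (M\<^sub>f + M\<^sub>P\<^sub>1 + M\<^sub>P\<^sub>2 + c2 * (M\<^sub>L + \<mu> 0 * L\<mu>0)))) (\<gamma>hat (k0 + 1));
             \<II> = {k. t (Suc k) \<noteq> t k};
             T = {s. \<gamma>hat s \<ge> \<eta>\<^sub>\<gamma>};
             Mt = Max T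
         in (\<exists>k. \<mu>small k) \<and>
            \<eta>\<^sub>\<gamma> > 0 \<and> (\<forall>k. \<gamma> k \<ge> \<eta>\<^sub>\<gamma>) \<and>
            finite T \<and> T \<noteq> {} \<and> k0 + 1 \<le> Mt \<and>
            finite \<II> \<and> card \<II> \<le> Mt"
proof -
  define A1 where "A1 = \<alpha>h1 + M\<^sub>h\<^sup>2 * \<alpha>\<phi>1"
  define A2 where "A2 = \<alpha>h2 + M\<^sub>h\<^sup>2 * \<alpha>\<phi>2"
  define Lm where "Lm m = M\<^sub>h * L\<^sub>c + A1 * M\<^sub>c\<^sup>2 + A2 * M\<^sub>c\<^sup>2 / m" for m
  define Lbound where "Lbound = max Lmax (c1 + \<gamma> 0 * \<mu> 0 * L\<^sub>f + \<mu> 0 * Lm (\<mu> 0))"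
  define Mf where "Mf = (SUP z\<in>C. norm (gradient f z))"
  define M1 where "M1 = sup_subgradient_norm P1 C"
  define M2 where "M2 = sup_subgradient_norm P2 C"
  define D where "D = Mf + M1 + M2 + c2 * (Lbound + \<mu> 0 * Lm (\<mu> 0))"
  define small where "small k \<longleftrightarrow> \<mu> k \<le> \<eta>1 / max (\<alpha>h31 + \<alpha>h32) (max \<alpha>h32 0)" for k
  define k0 where "k0 = (LEAST k. small k)"
  define \<eta> where "\<eta> = min (\<eta>1 / (2 * M\<gamma> * D)) (\<gamma>hat (k0 + 1))"
  define G where "G k = smooth_constraint \<phi>s hs c (\<mu> k)" for k
  have ah: "\<alpha>h1 \<ge> 0" "\<alpha>h2 > 0" "\<alpha>h31 + \<alpha>h32 > 0"
    and ap: "\<alpha>\<phi>1 \<ge> 0" "\<alpha>\<phi>2 > 0"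
    using hs(1) \<phi>s(1) by (auto simp: smoothing_approximation_def)
  have A: "A1 \<ge> 0" "A2 \<ge> 0" using ah ap by (auto simp: A1_def A2_def)
  from alg obtain \<xi> L0 y j where
    init: "x 0 \<in> C" "0 < Lmin" "Lmin \<le> Lmax" "c1 > 0" "c2 > 0" "t 0 = 0" and
    step: "\<forall>k. \<xi> k \<in> subdifferential (ereal \<circ> P2) (x k) \<and> L0 k \<in> {Lmin..Lmax} \<and>
        \<gamma> k = \<gamma>hat (t k) \<and>
        (\<forall>i\<le>j k. is_arg_min
           (subproblem_objective f P1 C (G k) (x k) (\<xi> k) (\<gamma> k) (\<mu> k) (2 ^ i * L0 k)) (\<lambda>_. True) (y k i)) \<and>
        (\<forall>i<j k. \<not> sufficient_descent (objective f P1 P2 C) (G k) c1 (\<gamma> k) (\<mu> k) (x k) (y k i)) \<and>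
        sufficient_descent (objective f P1 P2 C) (G k) c1 (\<gamma> k) (\<mu> k) (x k) (y k (j k)) \<and>
        x (Suc k) = y k (j k) \<and>
        t (Suc k) =
          (if hs (\<mu> k) (c (x (Suc k))) > 2 * (\<alpha>\<phi>31 + \<alpha>\<phi>32) * \<mu> k \<and>
              norm (x (Suc k) - x k) \<le> c2 * \<mu> k * \<gamma> k
           then t k + 1 else t k)"
    unfolding sESQM_def Let_def G_def by blast
  have \<xi>: "\<xi> k \<in> subdifferential (ereal \<circ> P2) (x k)"
    and L0mem: "L0 k \<in> {Lmin..Lmax}"
    and \<gamma>t: "\<gamma> k = \<gamma>hat (t k)"
    and arg: "i \<le> j k \<Longrightarrow> is_arg_min
      (subproblem_objective f P1 C (G k) (x k) (\<xi> k) (\<gamma> k) (\<mu> k) (2 ^ i * L0 k)) (\<lambda>_. True) (y k i)"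
    and fails: "i < j k \<Longrightarrow>
      \<not> sufficient_descent (objective f P1 P2 C) (G k) c1 (\<gamma> k) (\<mu> k) (x k) (y k i)"
    and xSuc: "x (Suc k) = y k (j k)"
    and tSuc: "t (Suc k) =
      (if hs (\<mu> k) (c (x (Suc k))) > 2 * (\<alpha>\<phi>31 + \<alpha>\<phi>32) * \<mu> k \<and>
          norm (x (Suc k) - x k) \<le> c2 * \<mu> k * \<gamma> k
       then t k + 1 else t k)" for i k
    using step by blast+
  have L0: "Lmin \<le> L0 k" "L0 k \<le> Lmax" for k using L0mem[of k] by auto
  have t_step: "t (Suc k) = t k \<or> t (Suc k) = t k + 1" for k using tSuc[of k] by auto
  have anti: "antimono \<gamma>hat" using gam(3) by (intro decseq_SucI) (auto intro: less_imp_le)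
  have \<gamma>pos: "\<gamma>hat s > 0" for s using gam(3)[of s] by linarith
  have \<gamma>0: "0 < \<gamma> k" "\<gamma> k \<le> \<gamma> 0" for k
    using \<gamma>pos antimonoD[OF anti, of 0 "t k"] by (auto simp: \<gamma>t init)
  have \<mu>0: "\<mu> k \<le> \<mu> 0" for k using mu(2) by (simp add: decseq_def)

  have xC: "x k \<in> C" for k
  proof (induction k)
    case (Suc k)
    then show ?case
      unfolding xSuc using subproblem_minimizer(1)[OF C(2) _ P(1) _ arg[of "j k" k]] \<gamma>0(1)[of k] by simp
  qed (rule init)
  have yC: "y k i \<in> C" if "i \<le> j k" for k i
    using subproblem_minimizer(1)[OF C(2) xC P(1) _ arg[OF that]] \<gamma>0(1)[of k] by simp
  have vi: "\<gamma> k * P1 (y k i) \<le> \<gamma> k * P1 z + (\<gamma> k *\<^sub>R (gradient f (x k) - \<xi> k) + gradient (G k) (x k)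
      + (2 ^ i * L0 k / \<mu> k) *\<^sub>R (y k i - x k)) \<bullet> (z - y k i)" if "i \<le> j k" "z \<in> C" for k i z
    using subproblem_minimizer(2)[OF C(2) xC P(1) _ arg[OF that(1)] that(2)] \<gamma>0(1)[of k] by simp

  define U where "U k y = gradient (\<phi>s (\<mu> k)) (hs (\<mu> k) y) *\<^sub>R gradient (hs (\<mu> k)) y" for k y
  note U = smoothing_composition[OF hs(1) \<phi>s(1) h(3) mu(1), folded U_def A1_def A2_def]
  have gradG: "GDERIV (G k) z :> adjoint (fderiv c z) (U k (c z))" for k z
    unfolding G_def smooth_constraint_def
    using gderiv_compose_adjoint[OF has_derivative_fderiv[OF c(1)] U(1)] .
  have G_lip: "\<bar>(gradient (G k) v - gradient (G k) u) \<bullet> (z - u)\<bar>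
      \<le> Lm (\<mu> k) * norm (v - u) * norm (z - u)" if "v \<in> C" "u \<in> C" "z \<in> C" for k v u z
  proof -
    have "A1 + A2 / \<mu> k \<ge> 0" using A mu(1)[of k] by simp
    from composition_gradient_lipschitz_feasible[where U = "U k", OF C(2) that c(1,3,5) U(2,3) this]
    show ?thesis
      by (simp add: gradient_unique[OF gradG] Lm_def distrib_right)
  qed
  have f_lip: "(gradient f v - gradient f u) \<bullet> (z - u) \<le> L\<^sub>f * norm (v - u) * norm (z - u)"
    if "v \<in> C" "u \<in> C" for v u z
  proof -
    have "(gradient f v - gradient f u) \<bullet> (z - u) = (fderiv f v - fderiv f u) (z - u)"
      by (simp add: fderiv_inner_gradient[OF f(1)] inner_diff_left blinfun.diff_left)
    also have "\<dots> \<le> norm (fderiv f v - fderiv f u) * norm (z - u)"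
      using norm_blinfun[of "fderiv f v - fderiv f u" "z - u"] by simp
    also have "\<dots> \<le> L\<^sub>f * norm (v - u) * norm (z - u)"
      using f(3) that by (intro mult_right_mono lipschitz_on_normD) (auto simp: smooth_on_def)
    finally show ?thesis .
  qed
  have f_descent: "f z \<le> f u + gradient f u \<bullet> (z - u) + L\<^sub>f / 2 * (norm (z - u))\<^sup>2"
    if "u \<in> C" "z \<in> C" for u z
    using that by (intro descent_lemma[OF C(2)] gderiv_gradient_C1[OF f(1)] f_lip)
  have G_descent: "G k z \<le> G k u + gradient (G k) u \<bullet> (z - u) + Lm (\<mu> k) / 2 * (norm (z - u))\<^sup>2"
    if "u \<in> C" "z \<in> C" for k u z
  proof (rule descent_lemma[OF C(2) that])
    show "GDERIV (G k) v :> gradient (G k) v" for v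
      using gradG gradient_unique[OF gradG] by simp
    show "(gradient (G k) v - gradient (G k) u) \<bullet> (z - u) \<le> Lm (\<mu> k) * norm (v - u) * norm (z - u)"
      if "v \<in> C" for v
      using G_lip[of v u z k] that \<open>u \<in> C\<close> \<open>z \<in> C\<close> by linarith
  qed

  \<comment> \<open>The product m * Lm m is affine in m with nonnegative slope.\<close>
  have \<mu>Lm: "\<mu> k * Lm (\<mu> k) \<le> \<mu> 0 * Lm (\<mu> 0)" "0 \<le> Lm (\<mu> k)" for k
  proof -
    have "m * Lm m = m * (M\<^sub>h * L\<^sub>c + A1 * M\<^sub>c\<^sup>2) + A2 * M\<^sub>c\<^sup>2" if "m > 0" for m
      using that by (simp add: Lm_def distrib_left)
    moreover have "\<mu> k * (M\<^sub>h * L\<^sub>c + A1 * M\<^sub>c\<^sup>2) \<le> \<mu> 0 * (M\<^sub>h * L\<^sub>c + A1 * M\<^sub>c\<^sup>2)"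
      using \<mu>0 h(2) c(2) A by (intro mult_right_mono) auto
    ultimately show "\<mu> k * Lm (\<mu> k) \<le> \<mu> 0 * Lm (\<mu> 0)" using mu(1) by simp
    show "0 \<le> Lm (\<mu> k)" using h(2) c(2) A mu(1)[of k] by (simp add: Lm_def)
  qed
  have L_le: "2 ^ j k * L0 k \<le> Lbound" for k
  proof -
    have "2 ^ j k * L0 k \<le> max Lmax (c1 + \<gamma> k * \<mu> k * L\<^sub>f + \<mu> k * Lm (\<mu> k))"
    proof (rule backtracking_constant_le[OF L0(2)], rule ccontr)
      fix i
      assume i: "i < j k" and "\<not> 2 * (2 ^ i * L0 k) < c1 + \<gamma> k * \<mu> k * L\<^sub>f + \<mu> k * Lm (\<mu> k)"
      then have "sufficient_descent (objective f P1 P2 C) (G k) c1 (\<gamma> k) (\<mu> k) (x k) (y k i)"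
        using xC[of k] yC[of i k] \<gamma>0(1)[of k] mu(1)[of k]
        by (intro sufficient_descent_of_large_constant[OF _ _ _ _ vi \<xi> f_descent G_descent]) auto
      then show False using fails[OF i] by simp
    qed
    moreover have "\<gamma> k * \<mu> k * L\<^sub>f \<le> \<gamma> 0 * \<mu> 0 * L\<^sub>f"
      using \<gamma>0 \<mu>0 mu(1) f(2) by (intro mult_right_mono mult_mono) (auto intro: less_imp_le)
    ultimately show ?thesis using \<mu>Lm(1)[of k] unfolding Lbound_def by linarith
  qed

  have Mf: "norm (gradient f z) \<le> Mf" if "z \<in> C" for z
    unfolding Mf_def using that bdd_above_norm_gradient[OF f(1) C(1)] by (rule cSUP_upper)
  have M1: "norm p \<le> M1" if "z \<in> C" "p \<in> subdifferential (ereal \<circ> P1) z" for z p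
    unfolding M1_def using norm_subgradient_le_sup[OF P(1) C(1) that] .
  have M2: "norm p \<le> M2" if "z \<in> C" "p \<in> subdifferential (ereal \<circ> P2) z" for z p
    unfolding M2_def using norm_subgradient_le_sup[OF P(2) C(1) that] .
  \<comment> \<open>Any subgradient of P1 at a point of C will do; the sum rule on a singleton provides one.\<close>
  have "M1 \<ge> 0"
  proof -
    have "P1 (x 1) \<le> P1 z + w \<bullet> (z - x 1)" if "z \<in> {x 1}" for z w using that by simp
    then obtain p where "p \<in> subdifferential (ereal \<circ> P1) (x 1)"
      using constrained_minimum_subgradient[OF P(1) convex_singleton, of "x 1" "x 1"] by blast
    from M1[OF xC this] show ?thesis using norm_ge_zero order_trans by blast
  qed
  moreover have "M2 \<ge> 0" using M2[OF xC \<xi>] norm_ge_zero order_trans by blast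
  moreover have "Mf \<ge> 0" using Mf[OF xC] norm_ge_zero order_trans by blast
  moreover have "Lbound > 0" using init unfolding Lbound_def by simp
  moreover have "\<mu> 0 * Lm (\<mu> 0) \<ge> 0" using \<mu>Lm(2) mu(1)[of 0] by simp
  ultimately have D: "D > 0" and Msum: "0 \<le> Mf + M1 + M2"
    using init(5) by (auto simp: D_def intro!: add_nonneg_pos)

  have max_pos: "max (\<alpha>h31 + \<alpha>h32) (max \<alpha>h32 0) > 0" using ah by simp
  have ex_small: "\<exists>k. small k"
  proof -
    have "\<eta>1 / max (\<alpha>h31 + \<alpha>h32) (max \<alpha>h32 0) > 0" using max_pos eta(1) by simp
    with mu(3) have "eventually (\<lambda>k. \<mu> k < \<eta>1 / max (\<alpha>h31 + \<alpha>h32) (max \<alpha>h32 0)) sequentially"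
      by (rule order_tendstoD)
    then show ?thesis unfolding small_def eventually_sequentially using less_imp_le by blast
  qed
  have small: "max (\<alpha>h31 + \<alpha>h32) (max \<alpha>h32 0) * \<mu> k \<le> \<eta>1" if "k \<ge> k0" for k
  proof -
    have "small k0" unfolding k0_def using ex_small by (rule LeastI_ex)
    then have "\<mu> k \<le> \<eta>1 / max (\<alpha>h31 + \<alpha>h32) (max \<alpha>h32 0)"
      using decseqD[OF mu(2) that] by (simp add: small_def)
    then show ?thesis using max_pos by (simp add: pos_le_divide_eq mult.commute)
  qed

  \<comment> \<open>The conflict between stationarity and regularity, for a reduction in iteration k.\<close>
  have large: "M\<gamma> * (\<eta>1 / (2 * M\<gamma> * D)) \<le> \<gamma>hat (t k)" if k: "k \<ge> k0" "t (Suc k) \<noteq> t k" for k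
  proof -
    let ?L = "2 ^ j k * L0 k" and ?n = "norm (x (Suc k) - x k)"
    have adv: "hs (\<mu> k) (c (x (Suc k))) > 2 * (\<alpha>\<phi>31 + \<alpha>\<phi>32) * \<mu> k" "?n \<le> c2 * \<mu> k * \<gamma> k"
      using k(2) tSuc[of k] by (auto split: if_splits)
    have L_nonneg: "?L \<ge> 0" using L0(1)[of k] init(2) by simp
    define B where "B = \<gamma> k * (Mf + M1 + M2) + (?L / \<mu> k + Lm (\<mu> k)) * ?n"
    have B0: "B \<ge> 0"
      using \<gamma>0(1)[of k] Msum L_nonneg mu(1)[of k] \<mu>Lm(2)[of k] by (simp add: B_def)
    have "(?L / \<mu> k + Lm (\<mu> k)) * ?n \<le> (?L / \<mu> k + Lm (\<mu> k)) * (c2 * \<mu> k * \<gamma> k)"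
      using adv(2) L_nonneg mu(1)[of k] \<mu>Lm(2)[of k] by (intro mult_left_mono) auto
    also have "\<dots> = \<gamma> k * (c2 * (?L + \<mu> k * Lm (\<mu> k)))"
      using mu(1)[of k] by (simp add: field_simps)
    also have "\<dots> \<le> \<gamma> k * (c2 * (Lbound + \<mu> 0 * Lm (\<mu> 0)))"
      using L_le[of k] \<mu>Lm(1)[of k] \<gamma>0(1)[of k] init(5) by (intro mult_left_mono add_mono) auto
    finally have BD: "B \<le> \<gamma> k * D" by (simp add: B_def D_def distrib_left)
    have "\<eta>1 \<le> 2 * B"
    proof (rule regularity_bounds_residual[OF C(2) xC c(1) hs(1) \<phi>s(1) h(3) mu(1) _ _ adv(1) _ B0])
      show "(\<alpha>h31 + \<alpha>h32) * \<mu> k \<le> \<eta>1" "max \<alpha>h32 0 * \<mu> k \<le> \<eta>1"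
        using small[OF k(1)] mu(1)[of k] by (auto elim!: order_trans[rotated] intro!: mult_right_mono)
      show "- (B * norm (z - x (Suc k))) \<le> gradient (smooth_constraint \<phi>s hs c (\<mu> k)) (x (Suc k)) \<bullet> (z - x (Suc k))"
        if "z \<in> C" for z
        unfolding B_def G_def[symmetric]
      proof (rule constraint_gradient_residual[OF C(2) xC P(1) \<gamma>0(1) mu(1) L_nonneg _ _ _ _ _ that])
        show "\<gamma> k * P1 (x (Suc k)) \<le> \<gamma> k * P1 z + (\<gamma> k *\<^sub>R (gradient f (x k) - \<xi> k)
          + gradient (G k) (x k) + (?L / \<mu> k) *\<^sub>R (x (Suc k) - x k)) \<bullet> (z - x (Suc k))"
          if "z \<in> C" for z using vi[of "j k" k z] that by (simp add: xSuc)
      qed (use G_lip xC Mf M1[OF xC] M2[OF xC \<xi>] in auto)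
      show "infdist 0 (adjoint (fderiv c (x (Suc k))) u +o normal_cone C (x (Suc k))) \<ge> \<eta>1"
        if "h (c (x (Suc k))) \<ge> - \<eta>1" "u \<in> eps_subdifferential \<eta>1 (ereal \<circ> h) (c (x (Suc k)))" for u
        using eta(2)[OF xC that] .
    qed
    then have "\<eta>1 \<le> \<gamma>hat (t k) * (2 * D)" using BD by (simp add: \<gamma>t)
    then have "\<eta>1 / (2 * D) \<le> \<gamma>hat (t k)" using D by (simp add: pos_divide_le_eq)
    then show ?thesis using gam(2) by simp
  qed

  have \<eta>: "\<eta> > 0" using eta(1) gam(2) D \<gamma>pos by (simp add: \<eta>_def)
  have lower: "\<eta> \<le> \<gamma> k" for k
    unfolding \<eta>_def \<gamma>t using gam(2,3)
    by (intro penalty_parameter_lower_bound[OF anti _ _ init(6) t_step large]) auto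
  define T where "T = {s. \<eta> \<le> \<gamma>hat s}"
  have T: "finite T"
  proof -
    obtain N where N: "\<And>s. s \<ge> N \<Longrightarrow> \<gamma>hat s < \<eta>"
      using order_tendstoD(2)[OF gam(1) \<eta>] unfolding eventually_sequentially by blast
    have "T \<subseteq> {..<N}" using N unfolding T_def by (force simp: not_less[symmetric])
    then show ?thesis by (rule finite_subset) simp
  qed
  have k0T: "k0 + 1 \<in> T" by (simp add: T_def \<eta>_def)
  have "t k \<le> Max T" for k using T lower[of k] by (intro Max_ge) (auto simp: T_def \<gamma>t)
  then have count: "finite {k. t (Suc k) \<noteq> t k} \<and> card {k. t (Suc k) \<noteq> t k} \<le> Max T"
    by (rule card_step_counter_changes[where t = t, OF t_step])
  have "(\<exists>k. small k) \<and> \<eta> > 0 \<and> (\<forall>k. \<gamma> k \<ge> \<eta>) \<and> finite T \<and> T \<noteq> {} \<and> k0 + 1 \<le> Max T \<and>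
      finite {k. t (Suc k) \<noteq> t k} \<and> card {k. t (Suc k) \<noteq> t k} \<le> Max T"
    using ex_small \<eta> lower T k0T count Max_ge[OF T k0T] by blast
  then show ?thesis
    unfolding Let_def T_def \<eta>_def k0_def small_def D_def M1_def M2_def Mf_def Lbound_def Lm_def A1_def A2_def .
qed

end
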